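(* Let $m$ be a positive integer. (i) If there exists a Hadamard matrix of order $m$ ($m\geq 2$), then $r'_2\big(K_{2,\frac{3m^2}{4}-1}\big)=CR\big(K_{2,\frac{3m^2}{4}-1},K_3\big)=m^2$. (ii) If there exists a graphical Hadamard matrix of order $4m^2$, then $r'_2(K_{2,3m^2-1})=CR(K_{2,3m^2-1},K_3)=4m^2$. (iii) If there exists a conference matrix of order $m+1$, then $r'_2\big(K_{2,\frac{3m^2+1}{4}}\big)=CR\big(K_{2,\frac{3m^2+1}{4}},K_3\big)=m^2+2$. (iv) If there exists a regular symmetric conference matrix of order $m^2+1$, then $r'_2\big(K_{2,\frac{3m^2+1}{4}}\big)=CR\big(K_{2,\frac{3m^2+1}{4}},K_3\big)=m^2+2$.
   Context: A Hadamard matrix $H$ of order $n$ is an $n\times n$ matrix with entries in $\{1,-1\}$ such that $HH^{\top}=nI_n$. It is graphical if it is symmetric and has a constant diagonal (all diagonal entries equal to $1$, or all equal to $-1$). A conference matrix $C=(c_{ij})$ of order $n$ is an $n\times n$ matrix with $c_{ii}=0$ for all $i$, $c_{ij}\in\{1,-1\}$ for all $i\neq j$, and $C^{\top}C=(n-1)I_n$. It is symmetric if $C=C^{\top}$, and regular if $C\mathbf{1}=\pm\sqrt{n-1}\,\mathbf{1}$, where $\mathbf{1}$ is the all-ones vector. (Under the stated hypotheses the indices $\frac{3m^2}{4}-1$ and $\frac{3m^2+1}{4}$ are integers.) An edge-colored graph $G$ on $p$ vertices with edge-coloring $\chi$ is called orderable if there exist an ordering $(v_1,\ldots,v_p)$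 of $V(G)$ and a list $(c_1,\ldots,c_{p-1})$ of not necessarily distinct colors such that for every edge $v_iv_j\in E(G)$ with $i<j$ we have $\chi(v_iv_j)=c_i$. An edge-colored graph is rainbow if all its edges have pairwise different colors. For a graph $G$, $r'_2(G)$ is the minimum integer $n$ such that every 2-edge-coloring of $K_n$ (each edge gets one of two given colors) contains an orderable copy of $G$. For graphs $G,H$, $CR(G,H)$ is the minimum integer $n$ such that every edge-coloring of $K_n$ with any number of colors contains either an orderable copy of $G$ or a rainbow copy of $H$. Copies are (not necessarily induced) subgraphs with the inherited coloring. *)

theory Defs
  imports Complex_Main "HOL-Library.Ramsey" "Jordan_Normal_Form.Matrix"
begin

text \<open>A simple graph is a pair of a finite vertex set and a set of 2-element subsets of it.
  An edge-coloring of such a graph is a function on edges; its values on other sets play no role.\<close>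

type_synonym 'a graph = "'a set \<times> 'a set set"

abbreviation verts :: "'a graph \<Rightarrow> 'a set" where "verts \<equiv> fst"
abbreviation edges :: "'a graph \<Rightarrow> 'a set set" where "edges \<equiv> snd"

definition simple_graph :: "'a graph \<Rightarrow> bool" where
  "simple_graph G \<longleftrightarrow> finite (verts G) \<and> edges G \<subseteq> nsets (verts G) 2"

definition complete_graph :: "nat \<Rightarrow> nat graph" where
  "complete_graph n = ({..<n}, nsets {..<n} 2)"

definition complete_bipartite :: "nat \<Rightarrow> nat \<Rightarrow> nat graph" where
  "complete_bipartite s t = ({..<s + t}, {{i, j} | i j. i < s \<and> s \<le> j \<and> j < s + t})"

definition graph_iso :: "'a graph \<Rightarrow> 'b graph \<Rightarrow> bool" where
  "graph_iso G H \<longleftrightarrow>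
     (\<exists>f. bij_betw f (verts G) (verts H) \<and>
        (\<forall>u\<in>verts G. \<forall>v\<in>verts G. {u, v} \<in> edges G \<longleftrightarrow> {f u, f v} \<in> edges H))"

definition copies :: "'a graph \<Rightarrow> 'b graph \<Rightarrow> 'b graph set" where
  "copies G K =
     {S. simple_graph S \<and> verts S \<subseteq> verts K \<and> edges S \<subseteq> edges K \<and> graph_iso G S}"

text \<open>Lists are indexed from 0, so the color \<open>cs ! i\<close> governs the edges from \<open>vs ! i\<close>
  to later vertices.\<close>

definition orderable :: "'a graph \<Rightarrow> ('a set \<Rightarrow> 'c) \<Rightarrow> bool" where
  "orderable G \<chi> \<longleftrightarrow>
     (\<exists>vs cs. distinct vs \<and> set vs = verts G \<and> length cs = length vs - 1 \<and>
        (\<forall>i j. i < j \<and> j < length vs \<and> {vs ! i, vs ! j} \<in> edges G \<longrightarrow>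
           \<chi> {vs ! i, vs ! j} = cs ! i))"

definition rainbow :: "'a graph \<Rightarrow> ('a set \<Rightarrow> 'c) \<Rightarrow> bool" where
  "rainbow G \<chi> \<longleftrightarrow> inj_on \<chi> (edges G)"

definition r2' :: "'a graph \<Rightarrow> nat" where
  "r2' G = (LEAST n. \<forall>\<chi> :: nat set \<Rightarrow> bool. \<exists>S \<in> copies G (complete_graph n). orderable S \<chi>)"

text \<open>Colors in \<open>nat\<close> are general enough, as \<open>K\<^sub>n\<close> has only finitely many edges.\<close>

definition CR :: "'a graph \<Rightarrow> 'b graph \<Rightarrow> nat" where
  "CR G H = (LEAST n. \<forall>\<chi> :: nat set \<Rightarrow> nat.
     (\<exists>S \<in> copies G (complete_graph n). orderable S \<chi>) \<or>
     (\<exists>S \<in> copies H (complete_graph n). rainbow S \<chi>))"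

definition hadamard_matrix :: "nat \<Rightarrow> real mat \<Rightarrow> bool" where
  "hadamard_matrix n H \<longleftrightarrow>
     H \<in> carrier_mat n n \<and> (\<forall>i<n. \<forall>j<n. H $$ (i, j) \<in> {1, -1}) \<and>
     H * transpose_mat H = real n \<cdot>\<^sub>m 1\<^sub>m n"

definition graphical_hadamard_matrix :: "nat \<Rightarrow> real mat \<Rightarrow> bool" where
  "graphical_hadamard_matrix n H \<longleftrightarrow>
     hadamard_matrix n H \<and> transpose_mat H = H \<and>
     ((\<forall>i<n. H $$ (i, i) = 1) \<or> (\<forall>i<n. H $$ (i, i) = -1))"

definition conference_matrix :: "nat \<Rightarrow> real mat \<Rightarrow> bool" where
  "conference_matrix n C \<longleftrightarrow>
     C \<in> carrier_mat n n \<and> (\<forall>i<n. C $$ (i, i) = 0) \<and>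
     (\<forall>i<n. \<forall>j<n. i \<noteq> j \<longrightarrow> C $$ (i, j) \<in> {1, -1}) \<and>
     transpose_mat C * C = (real n - 1) \<cdot>\<^sub>m 1\<^sub>m n"

definition symmetric_conference_matrix :: "nat \<Rightarrow> real mat \<Rightarrow> bool" where
  "symmetric_conference_matrix n C \<longleftrightarrow> conference_matrix n C \<and> transpose_mat C = C"

definition all_ones_vec :: "nat \<Rightarrow> real vec" where
  "all_ones_vec n = vec n (\<lambda>_. 1)"

definition regular_conference_matrix :: "nat \<Rightarrow> real mat \<Rightarrow> bool" where
  "regular_conference_matrix n C \<longleftrightarrow>
     conference_matrix n C \<and>
     (C *\<^sub>v all_ones_vec n = sqrt (real n - 1) \<cdot>\<^sub>v all_ones_vec n \<or>
      C *\<^sub>v all_ones_vec n = - sqrt (real n - 1) \<cdot>\<^sub>v all_ones_vec n)"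

end

theory Submission
  imports Defs "Jordan_Normal_Form.Determinant"
begin

text \<open>Placing the two centers \<open>u\<close>, \<open>v\<close> in this order, an orderable copy of \<open>K\<^bsub>2,t\<^esub>\<close> on them exists
  iff for some color \<open>a\<close> at least \<open>t\<close> vertices \<open>w\<close> satisfy \<open>\<chi>(uw) = \<chi>(vw)\<close> or \<open>\<chi>(uw) = a\<close>.
  In a coloring of \<open>K\<^sub>n\<close> without rainbow triangles some pair \<open>u\<close>, \<open>v\<close> disagrees in at most
  \<open>(n - 1)/2\<close> positions: for two colors by averaging, in general by Gallai's decomposition into
  homogeneous sets. Where \<open>u\<close> and \<open>v\<close> disagree, one of the two edges has the color of \<open>uv\<close>, so
  taking this color for \<open>a\<close> and the better order of \<open>u\<close>, \<open>v\<close> at most \<open>(n - 1)/4\<close> vertices are lost.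
  Equality requires every pair to disagree in about half of the positions, equally often in both
  directions, which is what a graphical Hadamard matrix with one vertex deleted, or a regular
  symmetric conference matrix, provides. Arbitrary Hadamard matrices (order \<open>m\<close>) and conference
  matrices (order \<open>m + 1\<close>) yield such matrices of order \<open>m\<^sup>2\<close> and \<open>m\<^sup>2 + 1\<close> by product constructions.\<close>

section \<open>Orderable copies of complete bipartite graphs\<close>

text \<open>Colors come from a function on vertices instead of a list. \<open>butlast\<close> fits
  the list length: the last vertex has no later neighbor and gets no color.\<close>

lemma orderableI:
  assumes "distinct vs" "set vs = verts G"
    and "sorted_wrt (\<lambda>x y. {x, y} \<in> edges G \<longrightarrow> \<chi> {x, y} = c x) vs"
  shows "orderable G \<chi>"
  unfolding orderable_def
proof (intro exI conjI allI impI)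
  show "distinct vs" "set vs = verts G" by fact+
  show "length (map c (butlast vs)) = length vs - 1" by simp
  fix i j assume ij: "i < j \<and> j < length vs \<and> {vs ! i, vs ! j} \<in> edges G"
  then have "\<chi> {vs ! i, vs ! j} = c (vs ! i)"
    using assms(3) by (auto simp: sorted_wrt_iff_nth_less)
  also have "\<dots> = map c (butlast vs) ! i"
  proof -
    have "i < length vs - 1" using ij by linarith
    then show ?thesis by (simp add: nth_butlast)
  qed
  finally show "\<chi> {vs ! i, vs ! j} = map c (butlast vs) ! i" .
qed

text \<open>The ordering is: leaves on which \<open>u\<close> and \<open>v\<close> agree, then
  \<open>u\<close> with color \<open>a\<close>, then the remaining leaves, then \<open>v\<close>. An
  early leaf sends one color to both centers, and a leaf after \<open>u\<close> has color
  \<open>a\<close> to \<open>u\<close> and only \<open>v\<close> behind it.\<close>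

lemma orderable_bipartite_copyI:
  assumes uv: "u < n" "v < n" "u \<noteq> v"
    and card: "t \<le> card {w \<in> {..<n} - {u, v}. \<chi> {u, w} = \<chi> {v, w} \<or> \<chi> {u, w} = a}"
  shows "\<exists>S \<in> copies (complete_bipartite 2 t) (complete_graph n). orderable S \<chi>"
proof -
  obtain W where W: "W \<subseteq> {w \<in> {..<n} - {u, v}. \<chi> {u, w} = \<chi> {v, w} \<or> \<chi> {u, w} = a}"
      "card W = t" "finite W"
    using obtain_subset_with_card_n[OF card] by blast
  obtain g where g: "bij_betw g {..<t} W"
    using W by (metis ex_bij_betw_nat_finite atLeast0LessThan)
  define S where "S = (insert u (insert v W), {{x, w} | x w. x \<in> {u, v} \<and> w \<in> W})"
  define f where "f i = (if i = 0 then u else if i = 1 then v else g (i - 2))" for i :: nat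
  have uvW: "u \<notin> W" "v \<notin> W" using W by auto
  have gW: "g i \<in> W" if "i < t" for i using g that by (auto simp: bij_betw_def)
  have gi: "i = j" if "i < t" "j < t" "g i = g j" for i j
    using g that by (auto simp: bij_betw_def inj_on_def)
  have f0: "f 0 = u" "f (Suc 0) = v" by (auto simp: f_def)
  have f2: "f (Suc (Suc i)) = g i" for i by (simp add: f_def)
  have split: "i = 0 \<or> i = Suc 0 \<or> (\<exists>k<t. i = Suc (Suc k))" if "i < 2 + t" for i
  proof -
    have "i = 0 \<or> i = Suc 0 \<or> (i = Suc (Suc (i - 2)) \<and> i - 2 < t)" using that by linarith
    then show ?thesis by blast
  qed
  have "inj_on f {..<2 + t}"
  proof (rule inj_onI)
    fix i j assume "i \<in> {..<2+t}" "j \<in> {..<2+t}" and eq: "f i = f j"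
    then have ij: "i < 2 + t" "j < 2 + t" by auto
    have gne: "g k \<noteq> u" "u \<noteq> g k" "g k \<noteq> v" "v \<noteq> g k" if "k < t" for k
      using gW[OF that] uvW by auto
    show "i = j"
      using split[OF ij(1)] split[OF ij(2)] eq uv(3)
      by (elim disjE exE conjE) (auto simp: f0 f2 gne dest: gi)
  qed
  moreover have "f ` {..<2 + t} = insert u (insert v W)"
  proof
    show "f ` {..<2 + t} \<subseteq> insert u (insert v W)"
    proof
      fix x assume "x \<in> f ` {..<2 + t}"
      then obtain i where i: "i < 2 + t" "x = f i" by auto
      show "x \<in> insert u (insert v W)"
        using split[OF i(1)] i(2) by (elim disjE exE conjE) (simp_all add: f0 f2 gW)
    qed
    show "insert u (insert v W) \<subseteq> f ` {..<2 + t}"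
    proof -
      have "u \<in> f ` {..<2 + t}" "v \<in> f ` {..<2 + t}"
        using f0 imageI[of 0 "{..<2 + t}" f] imageI[of "Suc 0" "{..<2 + t}" f] by simp_all
      moreover have "w \<in> f ` {..<2 + t}" if "w \<in> W" for w
      proof -
        obtain i where "i < t" "w = g i" using g \<open>w \<in> W\<close> by (auto simp: bij_betw_def)
        then show ?thesis by (intro image_eqI[of _ _ "Suc (Suc i)"]) (auto simp: f2)
      qed
      ultimately show ?thesis by blast
    qed
  qed
  ultimately have bij: "bij_betw f {..<2 + t} (insert u (insert v W))"
    by (simp add: bij_betw_def)
  have side: "f i \<in> W \<longleftrightarrow> 2 \<le> i" if "i < 2 + t" for i
    using split[OF that] by (elim disjE exE conjE) (simp_all add: f0 f2 gW uvW)
  have side': "f i \<in> {u, v} \<longleftrightarrow> i < 2" if "i < 2 + t" for i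
    using split[OF that] uv(3) by (elim disjE exE conjE) (use gW uvW in \<open>auto simp: f0 f2\<close>)
  have iso: "graph_iso (complete_bipartite 2 t) S"
    unfolding graph_iso_def
  proof (intro exI conjI ballI)
    show "bij_betw f (verts (complete_bipartite 2 t)) (verts S)"
      using bij by (simp add: complete_bipartite_def S_def)
    fix i j assume "i \<in> verts (complete_bipartite 2 t)" "j \<in> verts (complete_bipartite 2 t)"
    then have ij: "i < 2 + t" "j < 2 + t" by (auto simp: complete_bipartite_def)
    have "{i, j} \<in> edges (complete_bipartite 2 t) \<longleftrightarrow> (i < 2 \<and> 2 \<le> j) \<or> (j < 2 \<and> 2 \<le> i)"
      using ij by (auto simp: complete_bipartite_def doubleton_eq_iff)
    also have "\<dots> \<longleftrightarrow> (f i \<in> {u, v} \<and> f j \<in> W) \<or> (f j \<in> {u, v} \<and> f i \<in> W)"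
      using ij side side' by simp
    also have "\<dots> \<longleftrightarrow> {f i, f j} \<in> edges S"
      by (auto simp: S_def doubleton_eq_iff)
    finally show "{i, j} \<in> edges (complete_bipartite 2 t) \<longleftrightarrow> {f i, f j} \<in> edges S" .
  qed
  have WK: "W \<subseteq> {..<n}" using W by auto
  have "S \<in> copies (complete_bipartite 2 t) (complete_graph n)"
    using iso W(3) WK uvW uv
    by (auto simp: copies_def simple_graph_def S_def complete_graph_def doubleton_in_nsets_2)
  moreover have "orderable S \<chi>"
  proof -
    define A where "A = {w \<in> W. \<chi> {u, w} = \<chi> {v, w}}"
    obtain as where as: "distinct as" "set as = A"
      using W(3) finite_distinct_list[of A] by (auto simp: A_def)
    obtain bs where bs: "distinct bs" "set bs = W - A"
      using W(3) finite_distinct_list[of "W - A"] by auto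
    \<comment> \<open>For a leaf before \<open>u\<close>, the color toward \<open>v\<close> is also
      the color toward \<open>u\<close>; for a leaf after \<open>u\<close>, only the edge to
      \<open>v\<close> is left.\<close>
    define c where "c x = (if x = u then a else \<chi> {x, v})" for x
    show ?thesis
    proof (rule orderableI[where vs = "as @ u # bs @ [v]" and c = c])
      show "distinct (as @ u # bs @ [v])" using as bs uvW uv by (auto simp: A_def)
      show "set (as @ u # bs @ [v]) = verts S" using as bs by (auto simp: S_def A_def)
      have "sorted_wrt (\<lambda>x y. {x, y} \<in> edges S \<longrightarrow> \<chi> {x, y} = c x) xs" if "set xs \<subseteq> W" for xs
      proof -
        have "sorted_wrt (\<lambda>x y. True) xs" by (simp add: sorted_wrt_iff_nth_less)
        then show ?thesis
          by (rule sorted_wrt_mono_rel[rotated]) (use that uvW in \<open>auto simp: S_def doubleton_eq_iff\<close>)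
      qed
      then show "sorted_wrt (\<lambda>x y. {x, y} \<in> edges S \<longrightarrow> \<chi> {x, y} = c x) (as @ u # bs @ [v])"
        using as bs uvW uv W(1)
        by (auto simp: sorted_wrt_append S_def A_def c_def doubleton_eq_iff insert_commute)
    qed
  qed
  ultimately show ?thesis by blast
qed

text \<open>Take for \<open>u\<close> the center that comes first and for \<open>a\<close> its
  listed color. A leaf before \<open>u\<close> has the same color to both centers; a leaf after
  \<open>u\<close> receives \<open>a\<close> from \<open>u\<close>.\<close>

lemma orderable_bipartite_copyD:
  assumes S: "S \<in> copies (complete_bipartite 2 t) (complete_graph n)" and ord: "orderable S \<chi>"
  obtains u v a where "u < n" "v < n" "u \<noteq> v"
    "t \<le> card {w \<in> {..<n} - {u, v}. \<chi> {u, w} = \<chi> {v, w} \<or> \<chi> {u, w} = a}"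
proof -
  have SK: "verts S \<subseteq> {..<n}" using S by (auto simp: copies_def complete_graph_def)
  obtain f where bij: "bij_betw f {..<2 + t} (verts S)"
    and fe: "\<And>i j. i < 2 + t \<Longrightarrow> j < 2 + t \<Longrightarrow>
        {i, j} \<in> edges (complete_bipartite 2 t) \<longleftrightarrow> {f i, f j} \<in> edges S"
    using S by (auto simp: copies_def graph_iso_def complete_bipartite_def)
  have edge: "{f i, f j} \<in> edges S" if "i < 2" "2 \<le> j" "j < 2 + t" for i j
    using fe[of i j] that by (auto simp: complete_bipartite_def)
  obtain vs cs where vs: "distinct vs" "set vs = verts S"
    and cs: "\<And>i j. i < j \<Longrightarrow> j < length vs \<Longrightarrow> {vs ! i, vs ! j} \<in> edges S \<Longrightarrow>
        \<chi> {vs ! i, vs ! j} = cs ! i"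
    using ord unfolding orderable_def by auto
  have fin: "f i \<in> verts S" if "i < 2 + t" for i using bij that by (auto simp: bij_betw_def)
  have inj: "inj_on f {..<2 + t}" using bij by (simp add: bij_betw_def)
  have "\<exists>p. p < length vs \<and> vs ! p = f i" if "i < 2 + t" for i
    using fin[OF that] vs(2) by (metis in_set_conv_nth)
  then obtain pos where pos: "\<And>i. i < 2 + t \<Longrightarrow> pos i < length vs"
      "\<And>i. i < 2 + t \<Longrightarrow> vs ! pos i = f i"
    by metis
  note found = that
  have main: thesis if ij: "i < 2" "j < 2" "i \<noteq> j" and lt: "pos i < pos j" for i j
  proof (rule found)
    show "f i < n" "f j < n" using ij fin[of i] fin[of j] SK by auto
    show "f i \<noteq> f j" using inj_onD[OF inj, of i j] ij by auto
    let ?X = "{w \<in> {..<n} - {f i, f j}. \<chi> {f i, w} = \<chi> {f j, w} \<or> \<chi> {f i, w} = cs ! pos i}"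
    have "f ` {2..<2 + t} \<subseteq> ?X"
    proof
      fix w assume "w \<in> f ` {2..<2 + t}"
      then obtain k where k: "2 \<le> k" "k < 2 + t" "w = f k" by auto
      have "w \<noteq> f i" "w \<noteq> f j"
        using inj_onD[OF inj, of i k] inj_onD[OF inj, of j k] ij k by auto
      moreover have "w < n" using fin[of k] k SK by auto
      moreover have "\<chi> {f i, w} = \<chi> {f j, w} \<or> \<chi> {f i, w} = cs ! pos i"
      proof (cases "pos k < pos i")
        case True
        then have "\<chi> {vs ! pos k, vs ! pos i} = cs ! pos k" "\<chi> {vs ! pos k, vs ! pos j} = cs ! pos k"
          using lt ij k pos(1)[of i] pos(1)[of j] pos(2) edge[of i k] edge[of j k]
          by (intro cs; simp add: insert_commute)+
        then show ?thesis using k ij pos(2) by (simp add: insert_commute)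
      next
        case False
        have "pos k \<noteq> pos i"
        proof
          assume "pos k = pos i"
          then have "f k = f i" using pos(2)[of k] pos(2)[of i] ij k by simp
          then show False using \<open>w \<noteq> f i\<close> k by simp
        qed
        then have "\<chi> {vs ! pos i, vs ! pos k} = cs ! pos i"
          using False ij k pos edge[of i k] by (intro cs) auto
        then show ?thesis using k ij pos(2) by simp
      qed
      ultimately show "w \<in> ?X" by simp
    qed
    then have "card (f ` {2..<2 + t}) \<le> card ?X" by (intro card_mono) auto
    moreover have "inj_on f {2..<2 + t}" using inj by (rule inj_on_subset) auto
    ultimately show "t \<le> card ?X" by (simp add: card_image)
  qed
  have "pos 0 \<noteq> pos 1"
    using pos(2)[of 0] pos(2)[of 1] inj_onD[OF inj, of 0 1] by auto
  then show thesis using main[of 0 1] main[of 1 0] by linarith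
qed

section \<open>Rainbow triangles as copies\<close>

lemma rainbow_triangleI:
  assumes xyz: "x < n" "y < n" "z < n" "x \<noteq> y" "x \<noteq> z" "y \<noteq> z"
    and \<chi>: "\<chi> {x, y} \<noteq> \<chi> {x, z}" "\<chi> {x, y} \<noteq> \<chi> {y, z}" "\<chi> {x, z} \<noteq> \<chi> {y, z}"
  shows "\<exists>S \<in> copies (complete_graph 3) (complete_graph n). rainbow S \<chi>"
proof
  let ?S = "({x, y, z}, {{x, y}, {x, z}, {y, z}})"
  define f where "f i = (if i = 0 then x else if i = 1 then y else z)" for i :: nat
  have three: "{..<3::nat} = {0, 1, 2}" by auto
  have "graph_iso (complete_graph 3) ?S"
    unfolding graph_iso_def
  proof (intro exI[of _ f] conjI ballI)
    show "bij_betw f (verts (complete_graph 3)) (verts ?S)"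
      using xyz by (auto simp: complete_graph_def three bij_betw_def f_def)
    fix i j assume "i \<in> verts (complete_graph 3)" "j \<in> verts (complete_graph 3)"
    then show "{i, j} \<in> edges (complete_graph 3) \<longleftrightarrow> {f i, f j} \<in> edges ?S"
      using xyz by (auto simp: complete_graph_def three f_def nsets_def doubleton_eq_iff)
  qed
  then show "?S \<in> copies (complete_graph 3) (complete_graph n)"
    using xyz by (auto simp: copies_def simple_graph_def complete_graph_def nsets_def)
  show "rainbow ?S \<chi>" using \<chi> by (auto simp: rainbow_def)
qed

lemma no_rainbow_triangle_two_colors:
  assumes S: "S \<in> copies (complete_graph 3) (complete_graph n)"
    and two: "\<chi> ` edges S \<subseteq> {a, b}"
  shows "\<not> rainbow S \<chi>"
proof
  assume r: "rainbow S \<chi>"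
  obtain f where bij: "bij_betw f {..<3} (verts S)"
    and fe: "\<And>i j. i < 3 \<Longrightarrow> j < 3 \<Longrightarrow> {i, j} \<in> edges (complete_graph 3) \<longleftrightarrow> {f i, f j} \<in> edges S"
    using S by (auto simp: copies_def graph_iso_def complete_graph_def)
  have inj: "inj_on f {..<3}" using bij by (simp add: bij_betw_def)
  have ne: "f 0 \<noteq> f 1" "f 0 \<noteq> f 2" "f 1 \<noteq> f 2"
    using inj_onD[OF inj, of 0 1] inj_onD[OF inj, of 0 2] inj_onD[OF inj, of 1 2] by auto
  have e: "{f 0, f 1} \<in> edges S" "{f 0, f 2} \<in> edges S" "{f 1, f 2} \<in> edges S"
    using fe[of 0 1] fe[of 0 2] fe[of 1 2] by (auto simp: complete_graph_def nsets_def)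
  have "\<chi> {f 0, f 1} \<noteq> \<chi> {f 0, f 2}" "\<chi> {f 0, f 1} \<noteq> \<chi> {f 1, f 2}" "\<chi> {f 0, f 2} \<noteq> \<chi> {f 1, f 2}"
    using r e ne unfolding rainbow_def by (auto simp: inj_on_eq_iff doubleton_eq_iff)
  moreover have "\<chi> e \<in> {a, b}" if "e \<in> edges S" for e using two that by blast
  then have "\<chi> {f 0, f 1} \<in> {a, b}" "\<chi> {f 0, f 2} \<in> {a, b}" "\<chi> {f 1, f 2} \<in> {a, b}"
    using e by blast+
  ultimately show False by (metis insertE singletonD)
qed

section \<open>Colorings without rainbow triangles\<close>

text \<open>The coloring is curried and relative to a vertex set, so that inductions can pass to
  subsets; diagonal values are unconstrained.\<close>

definition gallai :: "'v set \<Rightarrow> ('v \<Rightarrow> 'v \<Rightarrow> 'c) \<Rightarrow> bool" where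
  "gallai V f \<longleftrightarrow> (\<forall>x\<in>V. \<forall>y\<in>V. f x y = f y x) \<and>
     (\<forall>x\<in>V. \<forall>y\<in>V. \<forall>z\<in>V. x \<noteq> y \<and> x \<noteq> z \<and> y \<noteq> z \<longrightarrow>
        f x y = f x z \<or> f x y = f y z \<or> f x z = f y z)"

text \<open>Connectedness of the graph of color \<open>c\<close> is phrased by cuts, not paths, so
  that an edge leaving a component is available at once.\<close>

definition color_connected :: "'v set \<Rightarrow> ('v \<Rightarrow> 'v \<Rightarrow> 'c) \<Rightarrow> 'c \<Rightarrow> bool" where
  "color_connected V f c \<longleftrightarrow> (\<forall>X. X \<subset> V \<and> X \<noteq> {} \<longrightarrow> (\<exists>x\<in>X. \<exists>y\<in>V - X. f x y = c))"

text \<open>Loops are left out, so each step joins two distinct vertices and the triangle condition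
  can be applied to it.\<close>

definition color_component :: "'v set \<Rightarrow> ('v \<Rightarrow> 'v \<Rightarrow> 'c) \<Rightarrow> 'c \<Rightarrow> 'v \<Rightarrow> 'v set" where
  "color_component V f c x = {(p, q). p \<in> V \<and> q \<in> V \<and> p \<noteq> q \<and> f p q = c}\<^sup>* `` {x}"

lemma gallai_sym: "gallai V f \<Longrightarrow> x \<in> V \<Longrightarrow> y \<in> V \<Longrightarrow> f x y = f y x"
  by (auto simp: gallai_def)

lemma gallai_triangle:
  assumes "gallai V f" "x \<in> V" "y \<in> V" "z \<in> V" "x \<noteq> y" "x \<noteq> z" "y \<noteq> z"
  shows "f x y = f x z \<or> f x y = f y z \<or> f x z = f y z"
  using assms unfolding gallai_def by blast

lemma gallai_subset: "gallai V f \<Longrightarrow> U \<subseteq> V \<Longrightarrow> gallai U f"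
  unfolding gallai_def by blast

lemma color_component_self: "x \<in> color_component V f c x"
  by (auto simp: color_component_def)

lemma color_component_subset:
  assumes "x \<in> V"
  shows "color_component V f c x \<subseteq> V"
proof
  fix y assume "y \<in> color_component V f c x"
  then have "(x, y) \<in> {(p, q). p \<in> V \<and> q \<in> V \<and> p \<noteq> q \<and> f p q = c}\<^sup>*"
    by (auto simp: color_component_def)
  then show "y \<in> V" by induction (use assms in auto)
qed

lemma color_component_step:
  assumes "x \<in> V" "y \<in> color_component V f c x" "z \<in> V" "f y z = c"
  shows "z \<in> color_component V f c x"
proof (cases "y = z")
  case False
  have "y \<in> V" using assms color_component_subset by fast
  then have "(y, z) \<in> {(p, q). p \<in> V \<and> q \<in> V \<and> p \<noteq> q \<and> f p q = c}"
    using assms False by auto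
  then show ?thesis
    using assms(2) unfolding color_component_def by (auto intro: rtrancl_into_rtrancl)
qed (use assms in auto)

lemma color_component_eq:
  assumes f: "gallai V f" and y: "y \<in> color_component V f c x"
  shows "color_component V f c y = color_component V f c x"
proof -
  let ?R = "{(p, q). p \<in> V \<and> q \<in> V \<and> p \<noteq> q \<and> f p q = c}"
  have "sym ?R" using gallai_sym[OF f] by (auto simp: sym_def)
  then have "sym (?R\<^sup>*)" by (rule sym_rtrancl)
  then have "(y, x) \<in> ?R\<^sup>*" "(x, y) \<in> ?R\<^sup>*"
    using y by (auto simp: color_component_def sym_def)
  then show ?thesis unfolding color_component_def by (auto intro: rtrancl_trans)
qed

text \<open>Along an edge \<open>p\<close>, \<open>q\<close> of color \<open>c\<close>, neither
  \<open>f p z\<close> nor \<open>f q z\<close> is \<open>c\<close>, as \<open>z\<close> lies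
  outside the component. The triangle is not rainbow, so the two are equal.\<close>

lemma color_component_homogeneous:
  assumes f: "gallai V f" and x: "x \<in> V" and y: "y \<in> color_component V f c x"
    and z: "z \<in> V" "z \<notin> color_component V f c x"
  shows "f y z = f x z"
proof -
  have "(x, y) \<in> {(p, q). p \<in> V \<and> q \<in> V \<and> p \<noteq> q \<and> f p q = c}\<^sup>*"
    using y by (auto simp: color_component_def)
  then show ?thesis
  proof induction
    case (step p q)
    have p: "p \<in> color_component V f c x" using step(1) by (auto simp: color_component_def)
    then have q: "q \<in> color_component V f c x" using step(2) x by (auto intro: color_component_step)
    have "f p z \<noteq> c" "f q z \<noteq> c" using color_component_step[OF x p z(1)] color_component_step[OF x q z(1)] z(2)
      by auto
    moreover have "p \<noteq> z" "q \<noteq> z" using p q z(2) by auto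
    ultimately have "f p z = f q z"
      using gallai_triangle[OF f, of p q z] step(2) z(1) by auto
    then show ?case using step.IH by simp
  qed simp
qed

text \<open>Paths of color \<open>c\<close> never cross a cut that \<open>c\<close> misses, so the
  component stays on the side of \<open>x\<close>.\<close>

lemma color_component_psubset:
  assumes f: "gallai V f" and "\<not> color_connected V f c" and x: "x \<in> V"
  shows "color_component V f c x \<subset> V"
proof -
  obtain X where X: "X \<subset> V" "X \<noteq> {}" "\<And>p q. p \<in> X \<Longrightarrow> q \<in> V - X \<Longrightarrow> f p q \<noteq> c"
    using assms(2) unfolding color_connected_def by blast
  have X': "f q p \<noteq> c" if "p \<in> X" "q \<in> V - X" for p q
    using X(3)[OF that] gallai_sym[OF f, of q p] that X(1) by auto
  have stay: "(y \<in> X) = (x \<in> X)" if "y \<in> color_component V f c x" for y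
  proof -
    have "(x, y) \<in> {(p, q). p \<in> V \<and> q \<in> V \<and> p \<noteq> q \<and> f p q = c}\<^sup>*"
      using that by (auto simp: color_component_def)
    then show ?thesis by induction (use X(3) X' in auto)
  qed
  obtain z where "z \<in> V" "(z \<in> X) \<noteq> (x \<in> X)" using X(1,2) by blast
  then show ?thesis using stay color_component_subset[OF x, of f c] by blast
qed

lemma color_connected_seen:
  assumes "color_connected V f c" "v \<in> V" "w \<in> V" "v \<noteq> w"
  shows "\<exists>z\<in>V - {v}. f v z = c"
  using assms unfolding color_connected_def by (elim allE[of _ "{v}"]) auto

text \<open>Adding \<open>v\<close> makes the color \<open>c\<close> connected, so \<open>v\<close> is joined by \<open>c\<close> to every component of
  \<open>c\<close> in \<open>W\<close>, which forces all its other edges to have one common color.\<close>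

lemma gallai_two_colors_aux:
  assumes f: "gallai (insert v W) f" and v: "v \<notin> W"
    and conn: "color_connected (insert v W) f c" and disc: "\<not> color_connected W f c"
    and x: "x \<in> W" "f v x \<noteq> c" and x': "x' \<in> W" "f v x' \<noteq> c"
  shows "f v x = f v x'"
proof -
  have fW: "gallai W f" using f by (rule gallai_subset) auto
  let ?K = "color_component W f c"
  \<comment> \<open>Inside \<open>W\<close> the component is closed under color \<open>c\<close>, so
    an edge of color \<open>c\<close> leaving it in the larger set ends in \<open>v\<close>.\<close>
  have contact: "\<exists>q\<in>?K p. f v q = c" if p: "p \<in> W" for p
  proof -
    have "?K p \<subset> insert v W" "?K p \<noteq> {}"
      using color_component_subset[OF p, of f c] color_component_self[of p W f c] v by auto
    then obtain q z where q: "q \<in> ?K p" "z \<in> insert v W - ?K p" "f q z = c"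
      using conn unfolding color_connected_def by meson
    have "z = v" using q color_component_step[OF p q(1)] by auto
    moreover have "q \<in> W" using q(1) color_component_subset[OF p, of f c] by auto
    ultimately show ?thesis using q gallai_sym[OF f, of q v] by auto
  qed
  \<comment> \<open>In the triangle \<open>v\<close>, \<open>p\<close>, \<open>q\<close> only the
    edge from \<open>v\<close> to \<open>q\<close> has color \<open>c\<close>, so the other two
    edges agree.\<close>
  have other: "f q p = f v p"
    if p: "p \<in> W" "f v p \<noteq> c" and q: "q \<in> W" "q \<notin> ?K p" "f v q = c" for p q
  proof -
    have "p \<noteq> q" using q(2) color_component_self[of p W f c] by auto
    moreover have "f p q \<noteq> c"
      using color_component_step[OF p(1) color_component_self q(1)] q(2) by auto
    moreover have "v \<noteq> p" "v \<noteq> q" using p(1) q(1) v by auto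
    ultimately have "f v p = f p q"
      using gallai_triangle[OF f, of v p q] p q by simp
    then show ?thesis using gallai_sym[OF fW p(1) q(1)] by simp
  qed
  show ?thesis
  proof (cases "x' \<in> ?K x")
    \<comment> \<open>A contact \<open>q\<close> in another component sees \<open>x\<close> and
      \<open>x'\<close> alike by homogeneity, and \<open>other\<close> transfers this to
      \<open>v\<close>.\<close>
    case True
    obtain z where z: "z \<in> W" "z \<notin> ?K x"
      using color_component_psubset[OF fW disc x(1)] by blast
    obtain q where q: "q \<in> ?K z" "f v q = c" using contact[OF z(1)] by blast
    have qW: "q \<in> W" using q(1) color_component_subset[OF z(1), of f c] by auto
    have "z \<in> ?K q" using color_component_eq[OF fW q(1)] color_component_self[of z W f c] by auto
    then have "q \<notin> ?K x" using color_component_eq[OF fW, of q c x] z(2) by auto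
    moreover have "?K x' = ?K x" using color_component_eq[OF fW True] .
    ultimately have "f q x = f v x" "f q x' = f v x'"
      using other[OF x qW] other[OF x' qW] q(2) by auto
    moreover have "f x' q = f x q"
      using color_component_homogeneous[OF fW x(1) True qW] \<open>q \<notin> ?K x\<close> by simp
    ultimately show ?thesis using gallai_sym[OF fW] x(1) x'(1) qW by metis
  next
    \<comment> \<open>With distinct components, \<open>f v x\<close> and \<open>f v x'\<close> both
      equal \<open>f x x'\<close>: each is compared with it through a contact in the opposite
      component.\<close>
    case False
    then have False': "?K x \<inter> ?K x' = {}"
      using color_component_eq[OF fW] color_component_self[of x' W f c] by blast
    obtain q where q: "q \<in> ?K x" "f v q = c" using contact[OF x(1)] by blast
    obtain q' where q': "q' \<in> ?K x'" "f v q' = c" using contact[OF x'(1)] by blast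
    have W: "q \<in> W" "q' \<in> W"
      using q q' color_component_subset[OF x(1), of f c] color_component_subset[OF x'(1), of f c]
      by auto
    have "f q' x = f v x" "f q x' = f v x'"
      using other[OF x W(2)] other[OF x' W(1)] q q' False' by auto
    moreover have "f q' x = f x' x"
      using color_component_homogeneous[OF fW x'(1) q'(1) x(1)] False' color_component_self[of x W f c]
      by blast
    moreover have "f q x' = f x x'"
      using color_component_homogeneous[OF fW x(1) q(1) x'(1)] False by blast
    ultimately show ?thesis using gallai_sym[OF fW x(1) x'(1)] by simp
  qed
qed

text \<open>Induction removes a vertex \<open>v\<close>. By connectedness every color occurs at
  \<open>v\<close>, so it suffices to bound the colors there. If some color becomes disconnected in
  \<open>W\<close>, \<open>gallai_two_colors_aux\<close> does this; otherwise the induction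
  hypothesis leaves only two colors in \<open>W\<close>.\<close>

lemma gallai_connected_two_colors:
  assumes "finite V" "gallai V f"
    and "\<And>x y. x \<in> V \<Longrightarrow> y \<in> V \<Longrightarrow> x \<noteq> y \<Longrightarrow> color_connected V f (f x y)"
  shows "\<exists>a b. \<forall>x\<in>V. \<forall>y\<in>V. x \<noteq> y \<longrightarrow> f x y \<in> {a, b}"
  using assms
proof (induction V rule: finite_induct)
  case empty
  then show ?case by simp
next
  case (insert v W)
  have seen: "\<exists>z\<in>W. f v z = f p q" if "p \<in> insert v W" "q \<in> insert v W" "p \<noteq> q" for p q
  proof -
    have "W \<noteq> {}" using that by auto
    then obtain w where "w \<in> W" by blast
    then show ?thesis
      using color_connected_seen[OF insert.prems(2)[OF that], of v w] insert.hyps by auto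
  qed
  have seen_two: ?case if "\<forall>x\<in>W. f v x \<in> {a, b}" for a b
  proof (intro exI ballI impI)
    fix p q assume "p \<in> insert v W" "q \<in> insert v W" "p \<noteq> q"
    then show "f p q \<in> {a, b}" using seen[of p q] that by auto
  qed
  show ?case
  proof (cases "\<exists>p\<in>W. \<exists>q\<in>W. p \<noteq> q \<and> \<not> color_connected W f (f p q)")
    case True
    then obtain p q where pq: "p \<in> W" "q \<in> W" "p \<noteq> q" "\<not> color_connected W f (f p q)" by blast
    have "\<exists>b. \<forall>x\<in>W. f v x \<in> {f p q, b}"
    proof (cases "\<exists>x\<in>W. f v x \<noteq> f p q")
      case True
      then obtain x where x: "x \<in> W" "f v x \<noteq> f p q" by blast
      have "f v x' \<in> {f p q, f v x}" if "x' \<in> W" for x'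
      proof -
        have "color_connected (insert v W) f (f p q)" using pq by (intro insert.prems(2)) auto
        then show ?thesis
          using gallai_two_colors_aux[OF insert.prems(1) insert.hyps(2) _ pq(4) x that]
          by (cases "f v x' = f p q") auto
      qed
      then show ?thesis by blast
    qed auto
    then show ?thesis using seen_two by blast
  next
    case False
    have W: "gallai W f" using insert.prems(1) by (rule gallai_subset) auto
    have "\<exists>a b. \<forall>x\<in>W. \<forall>y\<in>W. x \<noteq> y \<longrightarrow> f x y \<in> {a, b}"
    proof (rule insert.IH[OF W])
      fix x y assume "x \<in> W" "y \<in> W" "x \<noteq> y"
      then show "color_connected W f (f x y)" using False by metis
    qed
    then obtain a b where ab: "\<And>x y. x \<in> W \<Longrightarrow> y \<in> W \<Longrightarrow> x \<noteq> y \<Longrightarrow> f x y \<in> {a, b}"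
      by metis
    show ?thesis
    proof (cases "\<forall>x\<in>W. f v x \<in> {a, b}")
      case True
      then show ?thesis by (rule seen_two)
    next
      case False
      then obtain x where x: "x \<in> W" "f v x \<notin> {a, b}" by blast
      \<comment> \<open>A third color does not occur within \<open>W\<close>, so \<open>w\<close>
        can see it only on the edge to \<open>v\<close>; hence all edges at \<open>v\<close> have
        this color.\<close>
      have "f v w = f v x" if w: "w \<in> W" for w
      proof -
        have "v \<noteq> x" "w \<noteq> v" using x(1) w insert.hyps(2) by auto
        then obtain z where z: "z \<in> insert v W - {w}" "f w z = f v x"
          using color_connected_seen[OF insert.prems(2)[of v x], of w v] x(1) w by auto
        have "z = v" using ab[of w z] z w x(2) by auto
        then show ?thesis using z gallai_sym[OF insert.prems(1), of w v] w by auto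
      qed
      then show ?thesis using seen_two[of "f v x" "f v x"] by simp
    qed
  qed
qed

section \<open>Pairs with few disagreements\<close>

text \<open>Double counting of triples in which \<open>u\<close> and \<open>v\<close> disagree at
  \<open>w\<close>: a fixed \<open>w\<close> splits the other vertices into two color classes, and
  only mixed pairs disagree, at most \<open>(n - 1)\<^sup>2 / 2\<close> ordered ones.\<close>

lemma disagreements_two_colors:
  assumes fin: "finite V" and V: "2 \<le> card V"
    and two: "\<And>x y. x \<in> V \<Longrightarrow> y \<in> V \<Longrightarrow> x \<noteq> y \<Longrightarrow> f x y \<in> {a, b}"
  shows "\<exists>u\<in>V. \<exists>v\<in>V. u \<noteq> v \<and> 2 * card {w \<in> V - {u, v}. f u w \<noteq> f v w} \<le> card V - 1"
proof (rule ccontr)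
  assume neg: "\<not> ?thesis"
  define g where "g u v w = (of_bool (u \<noteq> v \<and> w \<noteq> u \<and> w \<noteq> v \<and> f u w \<noteq> f v w) :: nat)" for u v w
  define n where "n = card V"
  have count: "(\<Sum>x\<in>V. of_bool (P x)) = card {x \<in> V. P x}" for P :: "'a \<Rightarrow> bool"
    using fin by (simp add: Int_def)
  \<comment> \<open>In the naturals, exceeding \<open>n - 1\<close> means being at least
    \<open>n\<close>; this gap of one yields the final contradiction.\<close>
  have lower: "n \<le> 2 * (\<Sum>w\<in>V. g u v w)" if "u \<in> V" "v \<in> V" "u \<noteq> v" for u v
  proof -
    have "(\<Sum>w\<in>V. g u v w) = card {w \<in> V - {u, v}. f u w \<noteq> f v w}"
      unfolding g_def count using that by (intro arg_cong[where f = card]) auto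
    moreover have "\<not> 2 * card {w \<in> V - {u, v}. f u w \<noteq> f v w} \<le> n - 1"
      using neg that unfolding n_def by blast
    ultimately show ?thesis by linarith
  qed
  have "n * (n - 1) * n = (\<Sum>u\<in>V. \<Sum>v\<in>V - {u}. n)"
    using fin by (simp add: n_def card_Diff_singleton)
  also have "\<dots> \<le> (\<Sum>u\<in>V. \<Sum>v\<in>V - {u}. 2 * (\<Sum>w\<in>V. g u v w))"
    by (intro sum_mono lower) auto
  also have "\<dots> \<le> (\<Sum>u\<in>V. \<Sum>v\<in>V. 2 * (\<Sum>w\<in>V. g u v w))"
    using fin by (intro sum_mono sum_mono2) auto
  also have "\<dots> = 2 * (\<Sum>u\<in>V. \<Sum>v\<in>V. \<Sum>w\<in>V. g u v w)"
    by (simp add: sum_distrib_left)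
  also have "(\<Sum>u\<in>V. \<Sum>v\<in>V. \<Sum>w\<in>V. g u v w) = (\<Sum>u\<in>V. \<Sum>w\<in>V. \<Sum>v\<in>V. g u v w)"
    by (intro sum.cong refl sum.swap)
  also have "\<dots> = (\<Sum>w\<in>V. \<Sum>u\<in>V. \<Sum>v\<in>V. g u v w)"
    by (rule sum.swap)
  finally have 1: "n * (n - 1) * n \<le> 2 * (\<Sum>w\<in>V. \<Sum>u\<in>V. \<Sum>v\<in>V. g u v w)" .
  have upper: "2 * (\<Sum>u\<in>V. \<Sum>v\<in>V. g u v w) \<le> (n - 1)\<^sup>2" if w: "w \<in> V" for w
  proof -
    define A where "A = {u \<in> V. u \<noteq> w \<and> f u w = a}"
    define B where "B = {u \<in> V. u \<noteq> w \<and> f u w \<noteq> a}"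
    have "A \<union> B = V - {w}" "A \<inter> B = {}" "finite A" "finite B"
      using fin by (auto simp: A_def B_def)
    then have AB: "card A + card B = n - 1"
      using card_Un_disjoint[of A B] fin w by (simp add: n_def)
    have "(\<Sum>u\<in>V. \<Sum>v\<in>V. g u v w) \<le>
        (\<Sum>u\<in>V. \<Sum>v\<in>V. of_bool (u \<in> A) * of_bool (v \<in> B) + of_bool (u \<in> B) * of_bool (v \<in> A))"
          proof (intro sum_mono)
      fix u v assume uv: "u \<in> V" "v \<in> V"
      show "g u v w \<le> of_bool (u \<in> A) * of_bool (v \<in> B) + of_bool (u \<in> B) * of_bool (v \<in> A)"
      proof (cases "g u v w = 0")
        case False
        then have "u \<noteq> w" "v \<noteq> w" "f u w \<noteq> f v w" by (auto simp: g_def)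
        then have "u \<in> A \<and> v \<in> B \<or> u \<in> B \<and> v \<in> A"
          using two[OF uv(1) w] two[OF uv(2) w] uv by (auto simp: A_def B_def)
        then show ?thesis by (auto simp: g_def)
      qed simp
    qed
    also have "\<dots> = (\<Sum>u\<in>V. of_bool (u \<in> A)) * (\<Sum>v\<in>V. of_bool (v \<in> B)) +
        (\<Sum>u\<in>V. of_bool (u \<in> B)) * (\<Sum>v\<in>V. of_bool (v \<in> A))"
      unfolding sum_product by (simp only: sum.distrib)
    also have "\<dots> = 2 * (card A * card B)"
    proof -
      have "{x \<in> V. x \<in> A} = A" "{x \<in> V. x \<in> B} = B" by (auto simp: A_def B_def)
      then show ?thesis unfolding count by simp
    qed
    finally have "2 * (\<Sum>u\<in>V. \<Sum>v\<in>V. g u v w) \<le> 4 * (card A * card B)" by simp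
    also have "\<dots> \<le> (card A + card B)\<^sup>2"
    proof -
      \<comment> \<open>The difference is taken in the integers, where it is not truncated.\<close>
      have "0 \<le> (int (card A) - int (card B))\<^sup>2" by simp
      then have "4 * (int (card A) * int (card B)) \<le> (int (card A) + int (card B))\<^sup>2"
        by (simp add: power2_eq_square algebra_simps)
      then show ?thesis by (metis of_nat_add of_nat_le_iff of_nat_mult of_nat_numeral of_nat_power)
    qed
    finally show ?thesis unfolding AB .
  qed
  have "2 * (\<Sum>w\<in>V. \<Sum>u\<in>V. \<Sum>v\<in>V. g u v w) = (\<Sum>w\<in>V. 2 * (\<Sum>u\<in>V. \<Sum>v\<in>V. g u v w))"
    by (simp add: sum_distrib_left)
  also have "\<dots> \<le> (\<Sum>w\<in>V. (n - 1)\<^sup>2)" by (intro sum_mono upper)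
  also have "\<dots> = n * (n - 1) * (n - 1)" by (simp add: n_def power2_eq_square)
  finally have "n * (n - 1) * n \<le> n * (n - 1) * (n - 1)" using 1 by linarith
  then show False using V by (simp add: n_def)
qed

text \<open>A component of a disconnected color is homogeneous, so disagreements inside it are not
  increased by the vertices outside; otherwise the coloring has only two colors.\<close>

lemma gallai_disagreements:
  assumes "finite V" "2 \<le> card V" "gallai V f"
  shows "\<exists>u\<in>V. \<exists>v\<in>V. u \<noteq> v \<and> 2 * card {w \<in> V - {u, v}. f u w \<noteq> f v w} \<le> card V - 1"
  using assms
proof (induction "card V" arbitrary: V rule: less_induct)
  case less
  show ?case
  proof (cases "\<forall>x\<in>V. \<forall>y\<in>V. x \<noteq> y \<longrightarrow> color_connected V f (f x y)")
    case True
    then obtain a b where "\<forall>x\<in>V. \<forall>y\<in>V. x \<noteq> y \<longrightarrow> f x y \<in> {a, b}"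
      using gallai_connected_two_colors[OF less.prems(1,3)] by blast
    then show ?thesis by (intro disagreements_two_colors[OF less.prems(1,2), of f a b]) simp
  next
    case False
    then obtain x y where xy: "x \<in> V" "y \<in> V" "x \<noteq> y" "\<not> color_connected V f (f x y)"
      by metis
    \<comment> \<open>\<open>M\<close> has at least two elements: \<open>y\<close> lies in it
      because the edge from \<open>x\<close> to \<open>y\<close> has the chosen color
      itself.\<close>
    define M where "M = color_component V f (f x y) x"
    have M: "M \<subset> V" "x \<in> M" "y \<in> M"
      using color_component_psubset[OF less.prems(3) xy(4,1)] color_component_self[of x V f "f x y"]
        color_component_step[OF xy(1) color_component_self xy(2) refl] unfolding M_def
      by simp_all
    have finM: "finite M" using M(1) less.prems(1) by (auto intro: finite_subset)
    have "card {x, y} \<le> card M" using M finM by (intro card_mono) auto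
    then have "2 \<le> card M" using xy(3) by simp
    moreover have lt: "card M < card V" using M(1) less.prems(1) by (rule psubset_card_mono[rotated])
    moreover have "gallai M f" using less.prems(3) M(1) by (auto intro: gallai_subset)
    ultimately obtain u v where uv: "u \<in> M" "v \<in> M" "u \<noteq> v"
        "2 * card {w \<in> M - {u, v}. f u w \<noteq> f v w} \<le> card M - 1"
      using less.hyps[of M] finM by blast
    have "f u w = f v w" if "w \<in> V" "w \<notin> M" for w
      using color_component_homogeneous[OF less.prems(3) xy(1), of _ "f x y" w] uv that
      unfolding M_def by metis
    then have "{w \<in> V - {u, v}. f u w \<noteq> f v w} = {w \<in> M - {u, v}. f u w \<noteq> f v w}"
      using M(1) by blast
    then have "2 * card {w \<in> V - {u, v}. f u w \<noteq> f v w} \<le> card V - 1"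
      using uv(4) lt by simp
    then show ?thesis using uv(1-3) M(1) by (meson psubsetD)
  qed
qed

section \<open>The upper bound\<close>

lemma gallai_good_pair:
  assumes V: "finite V" "2 \<le> card V" and f: "gallai V f"
  obtains u v a where "u \<in> V" "v \<in> V" "u \<noteq> v"
    "card {w \<in> V - {u, v}. f u w \<noteq> f v w \<and> f u w \<noteq> a} \<le> (card V - 1) div 4"
proof -
  obtain u v where uv: "u \<in> V" "v \<in> V" "u \<noteq> v"
    and d: "2 * card {w \<in> V - {u, v}. f u w \<noteq> f v w} \<le> card V - 1"
    using gallai_disagreements[OF assms] by blast
  define a where "a = f u v"
  \<comment> \<open>\<open>A\<close> and \<open>B\<close> collect the vertices lost in the two
    orders of the centers. They are disjoint, so the smaller one holds at most half of the
    disagreements.\<close>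
  define A where "A = {w \<in> V - {u, v}. f u w \<noteq> f v w \<and> f u w \<noteq> a}"
  define B where "B = {w \<in> V - {v, u}. f v w \<noteq> f u w \<and> f v w \<noteq> a}"
  have "f u w = a \<or> f v w = a" if "w \<in> V - {u, v}" "f u w \<noteq> f v w" for w
    using gallai_triangle[OF f, of u v w] uv that by (auto simp: a_def)
  then have "A \<inter> B = {}" by (auto simp: A_def B_def)
  then have "card A + card B = card (A \<union> B)"
    using V(1) by (intro card_Un_disjoint[symmetric]) (auto simp: A_def B_def)
  also have "\<dots> \<le> card {w \<in> V - {u, v}. f u w \<noteq> f v w}"
    using V(1) by (intro card_mono) (auto simp: A_def B_def)
  finally have "card A \<le> (card V - 1) div 4 \<or> card B \<le> (card V - 1) div 4"
    using d by linarith
  then show thesis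
    using that[of u v a] that[of v u a] uv by (auto simp: A_def B_def)
qed

text \<open>Of the \<open>n - 2\<close> possible leaves at most \<open>(n - 1) div 4\<close> are
  lost; the arithmetic hypothesis ensures that \<open>t\<close> remain.\<close>

lemma gallai_orderable_copy:
  assumes n: "2 \<le> n" "t + 2 + (n - 1) div 4 \<le> n"
    and f: "gallai {..<n} (\<lambda>x y. \<chi> {x, y})"
  shows "\<exists>S \<in> copies (complete_bipartite 2 t) (complete_graph n). orderable S \<chi>"
proof -
  obtain u v a where uv: "u < n" "v < n" "u \<noteq> v"
    and a: "card {w \<in> {..<n} - {u, v}. \<chi> {u, w} \<noteq> \<chi> {v, w} \<and> \<chi> {u, w} \<noteq> a} \<le> (n - 1) div 4"
    using gallai_good_pair[OF _ _ f] n(1) by auto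
  let ?G = "{w \<in> {..<n} - {u, v}. \<chi> {u, w} = \<chi> {v, w} \<or> \<chi> {u, w} = a}"
  let ?B = "{w \<in> {..<n} - {u, v}. \<chi> {u, w} \<noteq> \<chi> {v, w} \<and> \<chi> {u, w} \<noteq> a}"
  have "card ?G + card ?B = card (?G \<union> ?B)"
    by (intro card_Un_disjoint[symmetric]) auto
  also have "?G \<union> ?B = {..<n} - {u, v}" by blast
  also have "card ({..<n} - {u, v}) = n - 2"
    using uv by (subst card_Diff_subset) auto
  finally have "t \<le> card ?G" using a n(2) by linarith
  then show ?thesis by (rule orderable_bipartite_copyI[OF uv])
qed

section \<open>The lower bound and the common value of both numbers\<close>

text \<open>For centers in the order \<open>u\<close>, \<open>v\<close>, the hypothesis
  \<open>count\<close> leaves fewer than \<open>t\<close> usable leaves whatever \<open>a\<close>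
  is. The color type is a parameter because the two Ramsey numbers color with \<open>bool\<close>
  and with \<open>nat\<close>.\<close>

lemma no_orderable_copy:
  fixes V :: "'v set" and f :: "'v \<Rightarrow> 'v \<Rightarrow> bool" and p q :: 'c
  assumes V: "finite V" and sym: "\<And>x y. x \<in> V \<Longrightarrow> y \<in> V \<Longrightarrow> f x y = f y x"
    and count: "\<And>u v a. u \<in> V \<Longrightarrow> v \<in> V \<Longrightarrow> u \<noteq> v \<Longrightarrow>
      card V \<le> t + 1 + card {w \<in> V - {u, v}. f u w = a \<and> f v w \<noteq> a}"
    and pq: "p \<noteq> q" and n: "n \<le> card V"
  shows "\<exists>\<chi> :: nat set \<Rightarrow> 'c. range \<chi> \<subseteq> {p, q} \<and>
    (\<forall>S \<in> copies (complete_bipartite 2 t) (complete_graph n). \<not> orderable S \<chi>)"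
proof -
  obtain h where h: "bij_betw h {..<card V} V"
    using V by (metis ex_bij_betw_nat_finite atLeast0LessThan)
  have hV: "h i \<in> V" if "i < card V" for i using h that by (auto simp: bij_betw_def)
  have inj: "inj_on h {..<card V}" using h by (simp add: bij_betw_def)
  define \<chi> where "\<chi> e = (if \<exists>x y. e = {x, y} \<and> x < card V \<and> y < card V \<and> f (h x) (h y) then p else q)"
    for e
  have \<chi>: "\<chi> {x, y} = (if f (h x) (h y) then p else q)" if "x < card V" "y < card V" for x y
    using that sym hV by (auto simp: \<chi>_def doubleton_eq_iff)
  show ?thesis
  proof (intro exI[of _ \<chi>] conjI ballI)
    show "range \<chi> \<subseteq> {p, q}" by (auto simp: \<chi>_def)
    fix S assume S: "S \<in> copies (complete_bipartite 2 t) (complete_graph n)"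
    have "complete_graph n = ({..<n}, nsets {..<n} 2)" "{..<n} \<subseteq> {..<card V}"
      using n by (auto simp: complete_graph_def)
    then have S': "S \<in> copies (complete_bipartite 2 t) (complete_graph (card V))"
      using S nsets_mono[of "{..<n}" "{..<card V}" 2]
      by (auto simp: copies_def complete_graph_def)
    show "\<not> orderable S \<chi>"
    proof
      assume "orderable S \<chi>"
      then obtain u v a where uv: "u < card V" "v < card V" "u \<noteq> v"
        and a: "t \<le> card {w \<in> {..<card V} - {u, v}. \<chi> {u, w} = \<chi> {v, w} \<or> \<chi> {u, w} = a}"
        using orderable_bipartite_copyD[OF S'] by blast
      let ?G = "{w \<in> {..<card V} - {u, v}. \<chi> {u, w} = \<chi> {v, w} \<or> \<chi> {u, w} = a}"
      \<comment> \<open>\<open>a \<noteq> p\<close> is a truth value of \<open>f\<close> whose color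
        differs from \<open>a\<close>, also for \<open>a\<close> outside \<open>{p, q}\<close>. So
        the edge at \<open>u\<close> avoids \<open>a\<close>, and the edge at \<open>v\<close> has
        the other color.\<close>
      let ?B = "{w \<in> {..<card V} - {u, v}. f (h u) (h w) = (a \<noteq> p) \<and> f (h v) (h w) \<noteq> (a \<noteq> p)}"
      have huv: "h u \<noteq> h v" using inj_onD[OF inj, of u v] uv by auto
      have "?G \<inter> ?B = {}" using \<chi> uv pq by (auto split: if_splits)
      then have "card ?G + card ?B = card (?G \<union> ?B)"
        by (intro card_Un_disjoint[symmetric]) auto
      also have "\<dots> \<le> card ({..<card V} - {u, v})" by (intro card_mono) auto
      also have "\<dots> = card V - 2" using uv by (subst card_Diff_subset) auto
      finally have "t + card ?B \<le> card V - 2" using a by linarith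
      moreover have "card (h ` ?B) = card ?B"
        by (intro card_image inj_on_subset[OF inj]) auto
      moreover have "{w \<in> V - {h u, h v}. f (h u) w = (a \<noteq> p) \<and> f (h v) w \<noteq> (a \<noteq> p)} \<subseteq> h ` ?B"
        using h by (auto simp: bij_betw_def)
      then have "card {w \<in> V - {h u, h v}. f (h u) w = (a \<noteq> p) \<and> f (h v) w \<noteq> (a \<noteq> p)} \<le> card (h ` ?B)"
        by (intro card_mono) auto
      moreover have "card V \<le> t + 1 + card {w \<in> V - {h u, h v}. f (h u) w = (a \<noteq> p) \<and> f (h v) w \<noteq> (a \<noteq> p)}"
        using count[OF hV[OF uv(1)] hV[OF uv(2)] huv] .
      moreover have "card {u, v} \<le> card {..<card V}" using uv by (intro card_mono) auto
      then have "2 \<le> card V" using uv(3) by simp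
      ultimately show False by linarith
    qed
  qed
qed

text \<open>Two colors admit no rainbow triangle, so the same upper bound argument and the same
  coloring serve both numbers. The coloring lives on \<open>n - 1\<close> vertices and is restricted
  for every smaller \<open>k\<close>.\<close>

lemma ramsey_numbers_eqI:
  fixes V :: "'v set" and f :: "'v \<Rightarrow> 'v \<Rightarrow> bool"
  assumes V: "finite V" "card V + 1 = n" and n: "2 \<le> n" "t + 2 + (n - 1) div 4 \<le> n"
    and sym: "\<And>x y. x \<in> V \<Longrightarrow> y \<in> V \<Longrightarrow> f x y = f y x"
    and count: "\<And>u v a. u \<in> V \<Longrightarrow> v \<in> V \<Longrightarrow> u \<noteq> v \<Longrightarrow>
      card V \<le> t + 1 + card {w \<in> V - {u, v}. f u w = a \<and> f v w \<noteq> a}"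
  shows "r2' (complete_bipartite 2 t) = n \<and> CR (complete_bipartite 2 t) (complete_graph 3) = n"
proof
  show "r2' (complete_bipartite 2 t) = n"
    unfolding r2'_def
  proof (rule Least_equality)
    show "\<forall>\<chi> :: nat set \<Rightarrow> bool. \<exists>S \<in> copies (complete_bipartite 2 t) (complete_graph n). orderable S \<chi>"
      by (intro allI gallai_orderable_copy n) (auto simp: gallai_def insert_commute)
    fix k assume k: "\<forall>\<chi> :: nat set \<Rightarrow> bool. \<exists>S \<in> copies (complete_bipartite 2 t) (complete_graph k). orderable S \<chi>"
    show "n \<le> k"
    proof (rule ccontr)
      assume "\<not> n \<le> k"
      then have "k \<le> card V" using V(2) by linarith
      have "\<exists>\<chi> :: nat set \<Rightarrow> bool. range \<chi> \<subseteq> {True, False} \<and>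
          (\<forall>S \<in> copies (complete_bipartite 2 t) (complete_graph k). \<not> orderable S \<chi>)"
        by (rule no_orderable_copy[OF V(1) sym count _ \<open>k \<le> card V\<close>]) simp_all
      then show False using k by blast
    qed
  qed
  show "CR (complete_bipartite 2 t) (complete_graph 3) = n"
    unfolding CR_def
  proof (rule Least_equality)
    show "\<forall>\<chi> :: nat set \<Rightarrow> nat. (\<exists>S \<in> copies (complete_bipartite 2 t) (complete_graph n). orderable S \<chi>) \<or>
      (\<exists>S \<in> copies (complete_graph 3) (complete_graph n). rainbow S \<chi>)"
    proof (intro allI disjCI)
      fix \<chi> :: "nat set \<Rightarrow> nat"
      assume "\<not> (\<exists>S \<in> copies (complete_graph 3) (complete_graph n). rainbow S \<chi>)"
      then have "\<chi> {x, y} = \<chi> {x, z} \<or> \<chi> {x, y} = \<chi> {y, z} \<or> \<chi> {x, z} = \<chi> {y, z}"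
        if "x < n" "y < n" "z < n" "x \<noteq> y" "x \<noteq> z" "y \<noteq> z" for x y z
        using rainbow_triangleI[OF that, of \<chi>] by metis
      then have "gallai {..<n} (\<lambda>x y. \<chi> {x, y})"
        unfolding gallai_def by (simp add: insert_commute)
      then show "\<exists>S \<in> copies (complete_bipartite 2 t) (complete_graph n). orderable S \<chi>"
        by (rule gallai_orderable_copy[OF n])
    qed
    fix k assume k: "\<forall>\<chi> :: nat set \<Rightarrow> nat. (\<exists>S \<in> copies (complete_bipartite 2 t) (complete_graph k). orderable S \<chi>) \<or>
      (\<exists>S \<in> copies (complete_graph 3) (complete_graph k). rainbow S \<chi>)"
    show "n \<le> k"
    proof (rule ccontr)
      assume "\<not> n \<le> k"
      then have "k \<le> card V" using V(2) by linarith
      have "\<exists>\<chi> :: nat set \<Rightarrow> nat. range \<chi> \<subseteq> {0, 1} \<and>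
          (\<forall>S \<in> copies (complete_bipartite 2 t) (complete_graph k). \<not> orderable S \<chi>)"
        by (rule no_orderable_copy[OF V(1) sym count _ \<open>k \<le> card V\<close>]) simp_all
      then obtain \<chi> :: "nat set \<Rightarrow> nat" where r: "range \<chi> \<subseteq> {0, 1}" and
        "\<forall>S \<in> copies (complete_bipartite 2 t) (complete_graph k). \<not> orderable S \<chi>"
        by blast
      then obtain S where S: "S \<in> copies (complete_graph 3) (complete_graph k)" "rainbow S \<chi>"
        using k by blast
      have "\<chi> ` edges S \<subseteq> {0, 1}" by (rule order_trans[OF image_mono[OF subset_UNIV] r])
      from no_rainbow_triangle_two_colors[OF S(1) this] S(2) show False by contradiction
    qed
  qed
qed

section \<open>Hadamard and conference matrices\<close>

text \<open>For signs, the product of \<open>1 + x\<close> and \<open>1 - y\<close> is 4 on the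
  pattern and 0 elsewhere; its expansion is summed.\<close>

lemma card_sign_pattern:
  fixes x y :: "'v \<Rightarrow> real"
  assumes W: "finite W" and x: "\<And>w. w \<in> W \<Longrightarrow> x w \<in> {1, -1}" and y: "\<And>w. w \<in> W \<Longrightarrow> y w \<in> {1, -1}"
  shows "4 * real (card {w \<in> W. x w = 1 \<and> y w \<noteq> 1}) =
    real (card W) + sum x W - sum y W - (\<Sum>w\<in>W. x w * y w)"
proof -
  have count: "(\<Sum>w\<in>W. of_bool (P w)) = real (card {w \<in> W. P w})" for P
    using W by (simp add: Int_def)
  have "4 * real (card {w \<in> W. x w = 1 \<and> y w \<noteq> 1}) = (\<Sum>w\<in>W. 4 * of_bool (x w = 1 \<and> y w \<noteq> 1))"
    by (simp only: count[symmetric] sum_distrib_left)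
  also have "\<dots> = (\<Sum>w\<in>W. 1 + x w - y w - x w * y w)"
  proof (rule sum.cong)
    fix w assume "w \<in> W"
    then show "4 * of_bool (x w = 1 \<and> y w \<noteq> 1) = 1 + x w - y w - x w * y w"
      using x[of w] y[of w] by auto
  qed simp
  also have "\<dots> = real (card W) + sum x W - sum y W - (\<Sum>w\<in>W. x w * y w)"
    by (simp add: sum.distrib sum_subtractf)
  finally show ?thesis .
qed

text \<open>Equal sums make both directions of disagreement equally frequent; \<open>a\<close>
  selects the direction.\<close>

lemma card_sign_disagreements:
  fixes x y :: "'v \<Rightarrow> real"
  assumes W: "finite W" and x: "\<And>w. w \<in> W \<Longrightarrow> x w \<in> {1, -1}" and y: "\<And>w. w \<in> W \<Longrightarrow> y w \<in> {1, -1}"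
    and eq: "sum x W = sum y W"
  shows "4 * real (card {w \<in> W. (x w = 1) = a \<and> (y w = 1) \<noteq> a}) = real (card W) - (\<Sum>w\<in>W. x w * y w)"
proof (cases a)
  case True
  then show ?thesis using card_sign_pattern[OF W x y] eq by simp
next
  case False
  then have "{w \<in> W. (x w = 1) = a \<and> (y w = 1) \<noteq> a} = {w \<in> W. y w = 1 \<and> x w \<noteq> 1}" by auto
  then show ?thesis using card_sign_pattern[OF W y x] eq by (simp add: mult.commute)
qed

section \<open>Matrix conditions that determine the Ramsey numbers\<close>

text \<open>After switching, row \<open>z\<close> is constant; by orthogonality all other rows then have the same sum,
  and \<open>z\<close> itself is deleted.\<close>

lemma ramsey_of_graphical_hadamard:
  fixes V :: "'v set" and K :: "'v \<Rightarrow> 'v \<Rightarrow> real"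
  assumes V: "finite V" "card V = 4 * k" "0 < k"
    and pm: "\<And>x y. x \<in> V \<Longrightarrow> y \<in> V \<Longrightarrow> K x y \<in> {1, -1}"
    and sym: "\<And>x y. x \<in> V \<Longrightarrow> y \<in> V \<Longrightarrow> K x y = K y x"
    and diag: "\<And>x. x \<in> V \<Longrightarrow> K x x = \<delta>"
    and orth: "\<And>x y. x \<in> V \<Longrightarrow> y \<in> V \<Longrightarrow> x \<noteq> y \<Longrightarrow> (\<Sum>w\<in>V. K x w * K y w) = 0"
  shows "r2' (complete_bipartite 2 (3 * k - 1)) = 4 * k \<and>
    CR (complete_bipartite 2 (3 * k - 1)) (complete_graph 3) = 4 * k"
proof -
  have "V \<noteq> {}" using V by auto
  then obtain z where z: "z \<in> V" by blast
  \<comment> \<open>Conjugation by the diagonal matrix of row \<open>z\<close>: it preserves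
    symmetry, diagonal and orthogonality, and row \<open>z\<close> becomes constantly
    \<open>\<delta>\<close>.\<close>
  define L where "L x y = K z x * K x y * K z y" for x y
  have sq: "K x y * K x y = 1" if "x \<in> V" "y \<in> V" for x y using pm[OF that] by auto
  have \<delta>: "\<delta> = 1 \<or> \<delta> = -1" using pm[OF z z] diag[OF z] by auto
  have Lpm: "L x y \<in> {1, -1}" if "x \<in> V" "y \<in> V" for x y
    using pm[OF z that(1)] pm[OF z that(2)] pm[OF that] by (auto simp: L_def)
  have Lsym: "L x y = L y x" if "x \<in> V" "y \<in> V" for x y
    using sym[OF that] by (simp add: L_def)
  have Ldiag: "L x x = \<delta>" if "x \<in> V" for x
    using diag[OF that] sq[OF z that] by (simp add: L_def mult.commute mult.left_commute)
  have Lz: "L x z = \<delta>" if "x \<in> V" for x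
    using diag[OF z] sq[OF z that] sym[OF z that] by (simp add: L_def)
  have Lorth: "(\<Sum>w\<in>V. L x w * L y w) = 0" if "x \<in> V" "y \<in> V" "x \<noteq> y" for x y
  proof -
    have "(\<Sum>w\<in>V. L x w * L y w) = (\<Sum>w\<in>V. K z x * K z y * (K x w * K y w))"
    proof (rule sum.cong)
      fix w assume "w \<in> V"
      have "L x w * L y w = K z x * K z y * (K x w * K y w) * (K z w * K z w)"
        by (simp add: L_def)
      then show "L x w * L y w = K z x * K z y * (K x w * K y w)"
        using sq[OF z \<open>w \<in> V\<close>] by simp
    qed simp
    also have "\<dots> = 0" using orth[OF that] by (simp flip: sum_distrib_left)
    finally show ?thesis .
  qed
  have Lsum: "(\<Sum>w\<in>V. L x w) = 0" if "x \<in> V" "x \<noteq> z" for x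
  proof -
    have "(\<Sum>w\<in>V. L x w * \<delta>) = (\<Sum>w\<in>V. L x w * L z w)"
      using Lz Lsym z by (intro sum.cong) auto
    then have "(\<Sum>w\<in>V. L x w) * \<delta> = 0" using Lorth[OF that(1) z that(2)] by (simp add: sum_distrib_right)
    then show ?thesis using \<delta> by auto
  qed
  show ?thesis
  proof (rule ramsey_numbers_eqI[where V = "V - {z}" and f = "\<lambda>x y. L x y = 1"])
    show "finite (V - {z})" using V by simp
    show c: "card (V - {z}) + 1 = 4 * k" using V z by simp
    show "2 \<le> 4 * k" "3 * k - 1 + 2 + (4 * k - 1) div 4 \<le> 4 * k" using V(3) by linarith+
    show "(L x y = 1) = (L y x = 1)" if "x \<in> V - {z}" "y \<in> V - {z}" for x y
      using Lsym that by auto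
    fix u v a assume uv: "u \<in> V - {z}" "v \<in> V - {z}" "u \<noteq> v"
    define W where "W = V - {z} - {u, v}"
    have split: "sum g V = g z + g u + g v + sum g W" for g :: "'v \<Rightarrow> real"
    proof -
      have "V = insert z (insert u (insert v W))" using uv z by (auto simp: W_def)
      then have "sum g V = sum g (insert z (insert u (insert v W)))" by simp
      also have "\<dots> = g z + g u + g v + sum g W"
      proof -
        have "finite W" "z \<notin> insert u (insert v W)" "u \<notin> insert v W" "v \<notin> W"
          using uv V(1) by (auto simp: W_def)
        then show ?thesis by simp
      qed
      finally show ?thesis .
    qed
    have cW: "real (card W) = 4 * real k - 3"
      using split[of "\<lambda>_. 1"] V(2) by simp
    have "sum (L u) W = sum (L v) W"
      using split[of "L u"] split[of "L v"] Lsum[of u] Lsum[of v] uv z Lz[of u] Lz[of v] Ldiag[of u]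
        Ldiag[of v] Lsym[of u v] by simp
    then have "4 * real (card {w \<in> W. (L u w = 1) = a \<and> (L v w = 1) \<noteq> a}) =
        real (card W) - (\<Sum>w\<in>W. L u w * L v w)"
      using V(1) uv Lpm by (intro card_sign_disagreements) (auto simp: W_def)
    \<comment> \<open>The positions outside \<open>W\<close> contribute 1 at \<open>z\<close> and
      \<open>\<delta> * L u v\<close> at each of \<open>u\<close> and \<open>v\<close>.\<close>
    also have "(\<Sum>w\<in>W. L u w * L v w) = - 1 - 2 * \<delta> * L u v"
      using split[of "\<lambda>w. L u w * L v w"] Lorth[of u v] uv z Lz[of u] Lz[of v] Ldiag[of u]
        Ldiag[of v] Lsym[of u v] \<delta> by auto
    \<comment> \<open>With \<open>card W = 4 * k - 3\<close> the value is \<open>4 * k - 4\<close>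
      or \<open>4 * k\<close>, so at least \<open>k - 1\<close> vertices are lost, as
      \<open>count\<close> asks.\<close>
    also have "real (card W) - (- 1 - 2 * \<delta> * L u v) \<ge> 4 * real k - 4"
      using cW \<delta> Lpm[of u v] uv by auto
    finally have "real k \<le> real (card {w \<in> W. (L u w = 1) = a \<and> (L v w = 1) \<noteq> a}) + 1" by simp
    then have "k \<le> card {w \<in> W. (L u w = 1) = a \<and> (L v w = 1) \<noteq> a} + 1" by linarith
    then show "card (V - {z}) \<le> 3 * k - 1 + 1 +
        card {w \<in> V - {z} - {u, v}. (L u w = 1) = a \<and> (L v w = 1) \<noteq> a}"
      using c V(3) unfolding W_def by linarith
  qed
qed

text \<open>Deleting the positions \<open>u\<close> and \<open>v\<close> removes a zero and the
  common entry from each row. Sums stay equal and the inner product stays 0, so exactly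
  \<open>k\<close> of the remaining \<open>4 * k\<close> positions disagree in each
  direction.\<close>

lemma ramsey_of_regular_symmetric_conference:
  fixes V :: "'v set" and C :: "'v \<Rightarrow> 'v \<Rightarrow> real"
  assumes V: "finite V" "card V = 4 * k + 2"
    and diag: "\<And>x. x \<in> V \<Longrightarrow> C x x = 0"
    and pm: "\<And>x y. x \<in> V \<Longrightarrow> y \<in> V \<Longrightarrow> x \<noteq> y \<Longrightarrow> C x y \<in> {1, -1}"
    and sym: "\<And>x y. x \<in> V \<Longrightarrow> y \<in> V \<Longrightarrow> C x y = C y x"
    and orth: "\<And>x y. x \<in> V \<Longrightarrow> y \<in> V \<Longrightarrow> x \<noteq> y \<Longrightarrow> (\<Sum>w\<in>V. C x w * C y w) = 0"
    and regular: "\<And>x. x \<in> V \<Longrightarrow> (\<Sum>w\<in>V. C x w) = s"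
  shows "r2' (complete_bipartite 2 (3 * k + 1)) = 4 * k + 3 \<and>
    CR (complete_bipartite 2 (3 * k + 1)) (complete_graph 3) = 4 * k + 3"
proof (rule ramsey_numbers_eqI[where V = V and f = "\<lambda>x y. C x y = 1"])
  show "finite V" by fact
  show "card V + 1 = 4 * k + 3" using V by simp
  show "2 \<le> 4 * k + 3" "3 * k + 1 + 2 + (4 * k + 3 - 1) div 4 \<le> 4 * k + 3" by linarith+
  show "(C x y = 1) = (C y x = 1)" if "x \<in> V" "y \<in> V" for x y using sym that by auto
  fix u v a assume uv: "u \<in> V" "v \<in> V" "u \<noteq> v"
  define W where "W = V - {u, v}"
  have split: "sum g V = g u + g v + sum g W" for g :: "'v \<Rightarrow> real"
  proof -
    have "V = insert u (insert v W)" using uv by (auto simp: W_def)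
    then have "sum g V = sum g (insert u (insert v W))" by simp
    also have "\<dots> = g u + g v + sum g W"
      using uv V(1) by (simp add: W_def)
    finally show ?thesis .
  qed
  have cW: "real (card W) = 4 * real k"
    using split[of "\<lambda>_. 1"] V(2) by simp
  have "sum (C u) W = sum (C v) W"
    using split[of "C u"] split[of "C v"] regular[of u] regular[of v] uv diag[of u] diag[of v] sym[of u v]
    by simp
  then have "4 * real (card {w \<in> W. (C u w = 1) = a \<and> (C v w = 1) \<noteq> a}) =
      real (card W) - (\<Sum>w\<in>W. C u w * C v w)"
    using V(1) uv pm by (intro card_sign_disagreements) (auto simp: W_def)
  also have "(\<Sum>w\<in>W. C u w * C v w) = 0"
    using split[of "\<lambda>w. C u w * C v w"] orth[of u v] uv diag[of u] diag[of v] by simp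
  finally have "k = card {w \<in> W. (C u w = 1) = a \<and> (C v w = 1) \<noteq> a}" using cW by simp
  then show "card V \<le> 3 * k + 1 + 1 + card {w \<in> V - {u, v}. (C u w = 1) = a \<and> (C v w = 1) \<noteq> a}"
    using V unfolding W_def by linarith
qed

section \<open>Parity arguments and Turyn's construction from cores\<close>

lemma even_card_if_signs_cancel:
  fixes x :: "'v \<Rightarrow> real"
  assumes W: "finite W" and x: "\<And>w. w \<in> W \<Longrightarrow> x w \<in> {1, -1}" and sum: "sum x W = 0"
  shows "even (card W)"
proof -
  \<comment> \<open>Against the constant row -1 the pattern is just \<open>x w = 1\<close>, so the
    count shows that half of the signs are positive.\<close>
  have "4 * real (card {w \<in> W. x w = 1 \<and> - 1 \<noteq> (1 :: real)}) =
      real (card W) + sum x W - sum (\<lambda>_. - 1) W - (\<Sum>w\<in>W. x w * - 1)"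
    using W x by (intro card_sign_pattern) auto
  then have "2 * real (card {w \<in> W. x w = 1}) = real (card W)"
    using sum by (simp add: sum_negf)
  then have "card W = 2 * card {w \<in> W. x w = 1}" by linarith
  then show ?thesis by simp
qed

text \<open>Delsarte, Goethals and Seidel: counting common positive positions of two rows determines
  \<open>S i j + S j i\<close> modulo 4.\<close>

lemma core_symmetric_or_skew:
  fixes S :: "'i \<Rightarrow> 'i \<Rightarrow> real"
  assumes I: "finite I" "odd (card I)"
    and diag: "\<And>i. i \<in> I \<Longrightarrow> S i i = 0"
    and pm: "\<And>i j. i \<in> I \<Longrightarrow> j \<in> I \<Longrightarrow> i \<noteq> j \<Longrightarrow> S i j \<in> {1, -1}"
    and rows: "\<And>i. i \<in> I \<Longrightarrow> (\<Sum>k\<in>I. S i k) = 0"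
    and prod: "\<And>i j. i \<in> I \<Longrightarrow> j \<in> I \<Longrightarrow> i \<noteq> j \<Longrightarrow> (\<Sum>k\<in>I. S i k * S j k) = -1"
  shows "\<exists>\<sigma>\<in>{1, -1}. \<forall>i\<in>I. \<forall>j\<in>I. S i j = \<sigma> * S j i"
proof -
  \<comment> \<open>Symmetric for order 1 mod 4, skew for the remaining odd orders, which are 3 mod
    4.\<close>
  define \<sigma> :: real where "\<sigma> = (if card I mod 4 = 1 then 1 else -1)"
  have "S i j = \<sigma> * S j i" if ij: "i \<in> I" "j \<in> I" for i j
  proof (cases "i = j")
    case True
    then show ?thesis using diag ij by simp
  next
    case False
    define W where "W = I - {i, j}"
    have split: "sum g I = g i + g j + sum g W" for g :: "'i \<Rightarrow> real"
    proof -
      have "finite W" "i \<notin> insert j W" "j \<notin> W" "I = insert i (insert j W)"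
        using ij False I(1) by (auto simp: W_def)
      then show ?thesis by simp
    qed
    \<comment> \<open>Negating the second row turns the pattern into the positions where both
      entries are 1.\<close>
    define N where "N = card {w \<in> W. S i w = 1 \<and> - S j w \<noteq> 1}"
    have "4 * real N = real (card W) + sum (S i) W - sum (\<lambda>w. - S j w) W - (\<Sum>w\<in>W. S i w * - S j w)"
      unfolding N_def using pm ij I(1) by (intro card_sign_pattern) (force simp: W_def)+
    moreover have "real (card W) = real (card I) - 2"
      using split[of "\<lambda>_. 1"] by simp
    moreover have "sum (S i) W = - S i j" "sum (S j) W = - S j i"
      using split[of "S i"] split[of "S j"] rows diag ij by simp_all
    moreover have "(\<Sum>w\<in>W. S i w * S j w) = -1"
      using split[of "\<lambda>w. S i w * S j w"] prod[OF ij False] diag ij by simp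
    ultimately have sum: "S i j + S j i = real (card I) - 3 - 4 * real N"
      by (simp add: sum_negf)
    have pm': "S i j = 1 \<or> S i j = -1" "S j i = 1 \<or> S j i = -1"
      using pm ij False by auto
    show ?thesis
    proof (cases "card I mod 4 = 1")
      case True
      have "S i j + S j i \<noteq> 0"
      proof
        assume "S i j + S j i = 0"
        then have "card I = 4 * N + 3" using sum by linarith
        then show False using True by presburger
      qed
      then show ?thesis using pm' True by (auto simp: \<sigma>_def)
    next
      case mod4: False
      have "S i j + S j i = 0"
      proof (rule ccontr)
        assume "S i j + S j i \<noteq> 0"
        then have "S i j + S j i = 2 \<or> S i j + S j i = -2" using pm' by auto
        then have "card I = 4 * N + 5 \<or> card I = 4 * N + 1" using sum by linarith
        then show False using mod4 by presburger
      qed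
      then show ?thesis using mod4 by (simp add: \<sigma>_def)
    qed
  qed
  moreover have "\<sigma> \<in> {1, -1}" by (simp add: \<sigma>_def)
  ultimately show ?thesis by blast
qed

lemma sum_of_bool_times:
  fixes f :: "'i \<Rightarrow> real"
  assumes "finite I" "i \<in> I"
  shows "(\<Sum>k\<in>I. of_bool (i = k) * f k) = f i" "(\<Sum>k\<in>I. f k * of_bool (i = k)) = f i"
    "(\<Sum>k\<in>I. of_bool (i = k)) = (1 :: real)"
proof -
  have "(\<Sum>k\<in>I. of_bool (i = k) * g k) = g i" for g :: "'i \<Rightarrow> real"
  proof -
    have "(\<Sum>k\<in>I. of_bool (i = k) * g k) = (\<Sum>k\<in>I. if i = k then g k else 0)"
      by (intro sum.cong) auto
    then show ?thesis using assms by simp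
  qed
  from this[of f] this[of "\<lambda>_. 1"]
  show "(\<Sum>k\<in>I. of_bool (i = k) * f k) = f i" "(\<Sum>k\<in>I. f k * of_bool (i = k)) = f i"
    "(\<Sum>k\<in>I. of_bool (i = k)) = (1 :: real)"
    by (simp_all add: mult.commute)
qed

text \<open>Turyn's core \<open>S \<otimes> S + I \<otimes> J - J \<otimes> I\<close>, bordered to a symmetric conference matrix and then
  switched by \<open>x \<otimes> 1\<close> with \<open>x\<close> of sum 1 to make it regular; \<open>None\<close> indexes the border.\<close>

lemma ramsey_of_core:
  fixes S :: "'i \<Rightarrow> 'i \<Rightarrow> real"
  assumes I: "finite I" "odd (card I)" and k: "(card I)\<^sup>2 = 4 * k + 1"
    and diag: "\<And>i. i \<in> I \<Longrightarrow> S i i = 0"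
    and pm: "\<And>i j. i \<in> I \<Longrightarrow> j \<in> I \<Longrightarrow> i \<noteq> j \<Longrightarrow> S i j \<in> {1, -1}"
    and rows: "\<And>i. i \<in> I \<Longrightarrow> (\<Sum>k\<in>I. S i k) = 0"
    and prod: "\<And>i j. i \<in> I \<Longrightarrow> j \<in> I \<Longrightarrow> i \<noteq> j \<Longrightarrow> (\<Sum>k\<in>I. S i k * S j k) = -1"
  shows "r2' (complete_bipartite 2 (3 * k + 1)) = 4 * k + 3 \<and>
    CR (complete_bipartite 2 (3 * k + 1)) (complete_graph 3) = 4 * k + 3"
proof -
  define m where "m = real (card I)"
  have "\<exists>\<sigma>\<in>{1, -1}. \<forall>i\<in>I. \<forall>j\<in>I. S i j = \<sigma> * S j i"
    by (rule core_symmetric_or_skew[OF I diag pm rows prod])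
  then obtain \<sigma> where \<sigma>: "\<sigma> \<in> {1, -1}" "\<And>i j. i \<in> I \<Longrightarrow> j \<in> I \<Longrightarrow> S i j = \<sigma> * S j i"
    by blast
  \<comment> \<open>As \<open>card I\<close> is odd, this size leaves one more positive sign than
    negative ones, whence the sum 1.\<close>
  obtain A where A: "A \<subseteq> I" "card A = (card I + 1) div 2"
  proof -
    have "(card I + 1) div 2 \<le> card I" using odd_pos[OF I(2)] by linarith
    then show thesis by (rule obtain_subset_with_card_n) (rule that)
  qed
  define x :: "'i \<Rightarrow> real" where "x i = (if i \<in> A then 1 else -1)" for i
  have x_sq: "x i * x i = 1" and x_pm: "x i \<in> {1, -1}" for i by (simp_all add: x_def)
  have sum_x: "sum x I = 1"
  proof -
    have "sum x I = sum x A + sum x (I - A)" using I A by (simp add: sum.subset_diff)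
    also have "sum x A = real (card A)" by (simp add: x_def)
    also have "sum x (I - A) = - real (card (I - A))" by (simp add: x_def)
    also have "card (I - A) = card I - card A" using A I by (meson card_Diff_subset finite_subset)
    finally have "sum x I = real (card A) - real (card I - card A)" by simp
    also have "\<dots> = 1" using A(2) I(2) by (auto elim!: oddE)
    finally show ?thesis .
  qed
  have gram: "(\<Sum>k\<in>I. S i k * S j k) = m * of_bool (i = j) - 1" if "i \<in> I" "j \<in> I" for i j
  proof (cases "i = j")
    case True
    have "(\<Sum>k\<in>I. S i k * S i k) = (\<Sum>k\<in>I - {i}. S i k * S i k)"
      using I(1) that diag by (simp add: sum.remove[of I i])
    also have "\<dots> = (\<Sum>k\<in>I - {i}. 1)" using pm that by (intro sum.cong) force+
    also have "\<dots> = m - 1" using card.remove[OF I(1) that(1)] by (simp add: m_def)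
    finally show ?thesis using True by simp
  qed (use prod that in simp)
  define M where "M i a k c = S i k * S a c + of_bool (i = k) - of_bool (a = c)" for i a k c
  \<comment> \<open>The sign \<open>\<sigma>\<close> enters twice and cancels, so \<open>M\<close>
    is symmetric for skew \<open>S\<close> too.\<close>
  have M_sym: "M i a k c = M k c i a" if "i \<in> I" "a \<in> I" "k \<in> I" "c \<in> I" for i a k c
    using \<sigma>(1) \<sigma>(2)[of i k] \<sigma>(2)[of a c] that by (auto simp: M_def)
  have M_diag: "M i a i a = 0" if "i \<in> I" for i a
    using that diag by (simp add: M_def)
  \<comment> \<open>Off the diagonal exactly one of the three terms of \<open>M\<close> is nonzero,
    because \<open>S\<close> vanishes on its diagonal.\<close>
  have M_pm: "M i a k c \<in> {1, -1}" if "i \<in> I" "a \<in> I" "k \<in> I" "c \<in> I" "(i, a) \<noteq> (k, c)" for i a k c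
    using pm[of i k] pm[of a c] that diag by (cases "i = k"; cases "a = c") (auto simp: M_def)
  have sum2: "(\<Sum>k\<in>I. \<Sum>c\<in>I. F k * G c) = sum F I * sum G I" for F G :: "'i \<Rightarrow> real"
    by (simp add: sum_product)
  note delta = sum_of_bool_times[OF I(1)]
  \<comment> \<open>\<open>F\<close> will be 1 for orthogonality to the border and \<open>x\<close>
    for the row sums after switching.\<close>
  have M_rows: "(\<Sum>k\<in>I. \<Sum>c\<in>I. M i a k c * F k) = m * F i - sum F I"
    if "i \<in> I" "a \<in> I" for i a and F :: "'i \<Rightarrow> real"
  proof -
    have "(\<Sum>k\<in>I. \<Sum>c\<in>I. M i a k c * F k) =
        (\<Sum>k\<in>I. \<Sum>c\<in>I. (S i k * F k) * S a c + (of_bool (i = k) * F k) * 1 - F k * of_bool (a = c))"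
      by (simp add: M_def algebra_simps)
    also have "\<dots> = m * F i - sum F I"
      unfolding sum.distrib sum_subtractf sum2 using that rows delta by (simp add: m_def)
    finally show ?thesis .
  qed
  have M_gram: "(\<Sum>k\<in>I. \<Sum>c\<in>I. M i a k c * M j b k c) = m\<^sup>2 * of_bool (i = j \<and> a = b) - 1"
    if "i \<in> I" "a \<in> I" "j \<in> I" "b \<in> I" for i a j b
  proof -
    have "(\<Sum>k\<in>I. \<Sum>c\<in>I. M i a k c * M j b k c) =
       (\<Sum>k\<in>I. \<Sum>c\<in>I. (S i k * S j k) * (S a c * S b c) + (S i k * of_bool (j = k)) * S a c
          - S i k * (S a c * of_bool (b = c)) + (of_bool (i = k) * S j k) * S b c
          + (of_bool (i = k) * of_bool (j = k)) * 1 - of_bool (i = k) * of_bool (b = c)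
          - S j k * (of_bool (a = c) * S b c) - of_bool (j = k) * of_bool (a = c)
          + 1 * (of_bool (a = c) * of_bool (b = c)))"
      by (intro sum.cong refl) (simp add: M_def algebra_simps)
    \<comment> \<open>Every term with an unpaired row of \<open>S\<close> as a factor vanishes with
      its row sum; paired rows are evaluated by \<open>gram\<close>. Afterwards the terms linear in
      \<open>m\<close> cancel.\<close>
    also have "\<dots> = (m * of_bool (i = j) - 1) * (m * of_bool (a = b) - 1)
        + m * of_bool (j = i) - 1 - 1 + m * of_bool (b = a)"
      unfolding sum.distrib sum_subtractf sum2 using that gram rows delta by (simp add: m_def)
    also have "\<dots> = m\<^sup>2 * of_bool (i = j \<and> a = b) - 1"
      by (auto simp: algebra_simps power2_eq_square)
    finally show ?thesis .
  qed
  define V where "V = insert None (Some ` (I \<times> I))"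
  define B where "B p q = (case p of None \<Rightarrow> (case q of None \<Rightarrow> 0 | Some _ \<Rightarrow> 1)
      | Some (i, a) \<Rightarrow> (case q of None \<Rightarrow> 1 | Some (k, c) \<Rightarrow> M i a k c))" for p q
  define e where "e p = (case p of None \<Rightarrow> 1 | Some (i, a) \<Rightarrow> x i)" for p :: "('i \<times> 'i) option"
  define C where "C p q = e p * B p q * e q" for p q
  have sumV: "sum g V = g None + (\<Sum>k\<in>I. \<Sum>c\<in>I. g (Some (k, c)))" for g :: "('i \<times> 'i) option \<Rightarrow> real"
    using I(1) by (simp add: V_def sum.reindex sum.cartesian_product case_prod_unfold)
  have e_pm: "e p \<in> {1, -1}" for p by (auto simp: e_def x_def split: option.split)
  have e_sq: "e p * e p = 1" for p using e_pm[of p] by auto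
  have B_pm: "B p q \<in> {1, -1}" if "p \<in> V" "q \<in> V" "p \<noteq> q" for p q
  proof (cases "p = None \<or> q = None")
    case True
    then show ?thesis using that by (auto simp: V_def B_def)
  next
    case False
    then obtain i a k c where "p = Some (i, a)" "q = Some (k, c)" by auto
    then show ?thesis using M_pm[of i a k c] that by (auto simp: V_def B_def)
  qed
  have B_sym: "B p q = B q p" if "p \<in> V" "q \<in> V" for p q
    using that M_sym by (auto simp: V_def B_def)
  have B_orth: "(\<Sum>w\<in>V. B p w * B q w) = 0" if "p \<in> V" "q \<in> V" "p \<noteq> q" for p q
    using that M_rows[where F = "\<lambda>_. 1"] M_gram unfolding sumV by (auto simp: V_def B_def m_def)
  show ?thesis
  proof (rule ramsey_of_regular_symmetric_conference[where V = V and C = C and s = m])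
    show "finite V" using I by (simp add: V_def)
    have "card V = Suc (card (I \<times> I))"
      using I(1) by (simp add: V_def card_image)
    then show "card V = 4 * k + 2" using k by (simp add: card_cartesian_product power2_eq_square)
    show "C p p = 0" if "p \<in> V" for p
      using that M_diag by (auto simp: C_def B_def V_def)
    show "C p q \<in> {1, -1}" if "p \<in> V" "q \<in> V" "p \<noteq> q" for p q
      using B_pm[OF that] e_pm[of p] e_pm[of q] by (auto simp: C_def)
    show "C p q = C q p" if "p \<in> V" "q \<in> V" for p q
      using B_sym[OF that] by (simp add: C_def)
    show "(\<Sum>w\<in>V. C p w * C q w) = 0" if "p \<in> V" "q \<in> V" "p \<noteq> q" for p q
    proof -
      have "C p w * C q w = e p * e q * (B p w * B q w)" for w
      proof -
        have "C p w * C q w = e p * e q * (B p w * B q w) * (e w * e w)" by (simp add: C_def)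
        then show ?thesis by (simp add: e_sq)
      qed
      then show ?thesis using B_orth[OF that] by (simp flip: sum_distrib_left)
    qed
    show "(\<Sum>w\<in>V. C p w) = m" if "p \<in> V" for p
    proof (cases p)
      case None
      then show ?thesis unfolding sumV C_def
        by (simp add: B_def e_def sum_x m_def flip: sum_distrib_left)
    next
      case (Some q)
      obtain i a where q: "q = (i, a)" by (cases q)
      have ia: "i \<in> I" "a \<in> I" using that Some q by (auto simp: V_def)
      \<comment> \<open>With \<open>F = x\<close> in \<open>M_rows\<close>, the border entry 1
        cancels against \<open>sum x I\<close>, leaving \<open>m\<close> times a square.\<close>
      have "(\<Sum>w\<in>V. C p w) = x i * (1 + (\<Sum>k\<in>I. \<Sum>c\<in>I. M i a k c * x k))"
        unfolding sumV C_def Some q by (simp add: B_def e_def sum_distrib_left algebra_simps)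
      also have "\<dots> = m * (x i * x i)" unfolding M_rows[OF ia] sum_x by (simp add: algebra_simps)
      finally show ?thesis by (simp add: x_sq)
    qed
  qed
qed

section \<open>From matrices to functions on index sets\<close>

lemma hadamard_matrix_entry:
  "hadamard_matrix n H \<Longrightarrow> i < n \<Longrightarrow> j < n \<Longrightarrow> H $$ (i, j) \<in> {1, -1}"
  by (auto simp: hadamard_matrix_def)

lemma hadamard_matrix_rows:
  assumes H: "hadamard_matrix n H" and ij: "i < n" "j < n"
  shows "(\<Sum>k<n. H $$ (i, k) * H $$ (j, k)) = real n * of_bool (i = j)"
proof -
  have "dim_row H = n" "dim_col H = n" using H by (auto simp: hadamard_matrix_def)
  then have "(H * transpose_mat H) $$ (i, j) = (\<Sum>k<n. H $$ (i, k) * H $$ (j, k))"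
    using ij by (simp add: scalar_prod_def atLeast0LessThan)
  moreover have "(real n \<cdot>\<^sub>m 1\<^sub>m n) $$ (i, j) = real n * of_bool (i = j)"
    using ij by simp
  moreover have "H * transpose_mat H = real n \<cdot>\<^sub>m 1\<^sub>m n"
    using H by (simp add: hadamard_matrix_def)
  ultimately show ?thesis by metis
qed

text \<open>The scaled transpose is a right inverse of \<open>H\<close>, hence, the matrices being
  square, also a left inverse. This provides orthogonality of columns.\<close>

lemma hadamard_matrix_transpose:
  assumes H: "hadamard_matrix n H" and n: "0 < n"
  shows "hadamard_matrix n (transpose_mat H)"
proof -
  have c: "H \<in> carrier_mat n n" using H by (simp add: hadamard_matrix_def)
  have "H * ((1 / real n) \<cdot>\<^sub>m transpose_mat H) = (1 / real n) \<cdot>\<^sub>m (real n \<cdot>\<^sub>m 1\<^sub>m n)"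
    using H c by (simp add: hadamard_matrix_def mult_smult_distrib)
  also have "\<dots> = 1\<^sub>m n" using n by (intro eq_matI) auto
  finally have "H * ((1 / real n) \<cdot>\<^sub>m transpose_mat H) = 1\<^sub>m n" .
  from mat_mult_left_right_inverse[OF c _ this]
  have "((1 / real n) \<cdot>\<^sub>m transpose_mat H) * H = 1\<^sub>m n" using c by simp
  then have "(1 / real n) \<cdot>\<^sub>m (transpose_mat H * H) = 1\<^sub>m n"
    using c by (simp add: mult_smult_assoc_mat)
  then have "real n \<cdot>\<^sub>m ((1 / real n) \<cdot>\<^sub>m (transpose_mat H * H)) = real n \<cdot>\<^sub>m 1\<^sub>m n" by simp
  moreover have "real n \<cdot>\<^sub>m ((1 / real n) \<cdot>\<^sub>m (transpose_mat H * H)) = transpose_mat H * H"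
    using n c by (intro eq_matI) auto
  ultimately show ?thesis using H c by (auto simp: hadamard_matrix_def)
qed

text \<open>Each factor of \<open>K\<close> takes its row index from one pair and its column index
  from the other; hence \<open>K\<close> is symmetric with squares on the diagonal. The inner
  product of its rows \<open>(i, a)\<close> and \<open>(j, b)\<close> factors into that of columns
  \<open>a\<close>, \<open>b\<close> and that of rows \<open>i\<close>, \<open>j\<close> of
  \<open>H\<close>.\<close>

lemma ramsey_of_hadamard_matrix:
  assumes H: "hadamard_matrix m H" and m: "2 \<le> m" and k: "m\<^sup>2 = 4 * k"
  shows "r2' (complete_bipartite 2 (3 * k - 1)) = 4 * k \<and>
    CR (complete_bipartite 2 (3 * k - 1)) (complete_graph 3) = 4 * k"
proof -
  define K where "K p q = (case p of (i, a) \<Rightarrow> case q of (j, b) \<Rightarrow> H $$ (j, a) * H $$ (i, b))" for p q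
  note pm = hadamard_matrix_entry[OF H]
  have cols: "(\<Sum>j<m. H $$ (j, a) * H $$ (j, b)) = real m * of_bool (a = b)" if "a < m" "b < m" for a b
  proof -
    have "hadamard_matrix m (transpose_mat H)" using hadamard_matrix_transpose[OF H] m by simp
    moreover have "dim_row H = m" "dim_col H = m" using H by (auto simp: hadamard_matrix_def)
    ultimately show ?thesis using hadamard_matrix_rows[of m "transpose_mat H" a b] that by simp
  qed
  show ?thesis
  proof (rule ramsey_of_graphical_hadamard[where V = "{..<m} \<times> {..<m}" and K = K and \<delta> = 1])
    show "finite ({..<m} \<times> {..<m})" by simp
    show "card ({..<m} \<times> {..<m}) = 4 * k" using k by (simp add: card_cartesian_product power2_eq_square)
    show "0 < k" using k m by (cases "k = 0") auto
    show "K p q \<in> {1, -1}" if "p \<in> {..<m} \<times> {..<m}" "q \<in> {..<m} \<times> {..<m}" for p q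
    proof -
      obtain i a j b where "p = (i, a)" "q = (j, b)" by fastforce
      then show ?thesis using pm[of j a] pm[of i b] that by (auto simp: K_def)
    qed
    show "K p q = K q p" for p q by (simp add: K_def case_prod_unfold mult.commute)
    show "K p p = 1" if p: "p \<in> {..<m} \<times> {..<m}" for p
    proof -
      obtain i a where "p = (i, a)" by fastforce
      then show ?thesis using pm[of i a] p by (auto simp: K_def)
    qed
    show "(\<Sum>w\<in>{..<m} \<times> {..<m}. K p w * K q w) = 0"
      if "p \<in> {..<m} \<times> {..<m}" "q \<in> {..<m} \<times> {..<m}" "p \<noteq> q" for p q
    proof -
      obtain i a j b where pq: "p = (i, a)" "q = (j, b)" by fastforce
      have "(\<Sum>w\<in>{..<m} \<times> {..<m}. K p w * K q w) =
          (\<Sum>c<m. \<Sum>d<m. (H $$ (c, a) * H $$ (c, b)) * (H $$ (i, d) * H $$ (j, d)))"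
        by (simp add: pq K_def sum.cartesian_product' mult_ac)
      also have "\<dots> = (\<Sum>c<m. H $$ (c, a) * H $$ (c, b)) * (\<Sum>d<m. H $$ (i, d) * H $$ (j, d))"
        by (simp add: sum_product)
      also have "\<dots> = 0"
        using that pq cols[of a b] hadamard_matrix_rows[OF H, of i j] by auto
      finally show ?thesis .
    qed
  qed
qed

text \<open>The products of the first two rows are signs with sum 0. Evenness makes
  \<open>m\<^sup>2\<close> a multiple of 4.\<close>

lemma hadamard_matrix_even:
  assumes H: "hadamard_matrix m H" and m: "2 \<le> m"
  shows "even m"
proof -
  have "H $$ (0, k) * H $$ (1, k) \<in> {1, -1}" if "k < m" for k
    using hadamard_matrix_entry[OF H, of 0 k] hadamard_matrix_entry[OF H, of 1 k] that m by auto
  moreover have "(\<Sum>k<m. H $$ (0, k) * H $$ (1, k)) = 0"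
    using hadamard_matrix_rows[OF H, of 0 1] m by simp
  ultimately show ?thesis
    using even_card_if_signs_cancel[of "{..<m}" "\<lambda>k. H $$ (0, k) * H $$ (1, k)"] by simp
qed

lemma ramsey_of_graphical_hadamard_matrix:
  assumes H: "graphical_hadamard_matrix (4 * k) H" and k: "0 < k"
  shows "r2' (complete_bipartite 2 (3 * k - 1)) = 4 * k \<and>
    CR (complete_bipartite 2 (3 * k - 1)) (complete_graph 3) = 4 * k"
proof -
  have had: "hadamard_matrix (4 * k) H" and symm: "transpose_mat H = H"
    using H by (auto simp: graphical_hadamard_matrix_def)
  obtain \<delta> where \<delta>: "\<And>i. i < 4 * k \<Longrightarrow> H $$ (i, i) = \<delta>"
    using H by (auto simp: graphical_hadamard_matrix_def)
  have dim: "dim_row H = 4 * k" "dim_col H = 4 * k" using had by (auto simp: hadamard_matrix_def)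
  show ?thesis
  proof (rule ramsey_of_graphical_hadamard[where V = "{..<4 * k}" and K = "\<lambda>i j. H $$ (i, j)" and \<delta> = \<delta>])
    show "H $$ (i, j) = H $$ (j, i)" if "i \<in> {..<4 * k}" "j \<in> {..<4 * k}" for i j
      using that dim index_transpose_mat(1)[of i H j] unfolding symm by simp
    show "(\<Sum>w<4 * k. H $$ (i, w) * H $$ (j, w)) = 0"
      if "i \<in> {..<4 * k}" "j \<in> {..<4 * k}" "i \<noteq> j" for i j
      using hadamard_matrix_rows[OF had, of i j] that by simp
  qed (use k \<delta> hadamard_matrix_entry[OF had] in auto)
qed

lemma conference_matrix_columns:
  assumes C: "conference_matrix n C" and ij: "i < n" "j < n" "i \<noteq> j"
  shows "(\<Sum>k<n. C $$ (k, i) * C $$ (k, j)) = 0"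
proof -
  have "dim_row C = n" "dim_col C = n" using C by (auto simp: conference_matrix_def)
  then have "(transpose_mat C * C) $$ (i, j) = (\<Sum>k<n. C $$ (k, i) * C $$ (k, j))"
    using ij by (simp add: scalar_prod_def atLeast0LessThan)
  moreover have "transpose_mat C * C = (real n - 1) \<cdot>\<^sub>m 1\<^sub>m n"
    using C by (simp add: conference_matrix_def)
  moreover have "((real n - 1) \<cdot>\<^sub>m 1\<^sub>m n) $$ (i, j) = 0" using ij by simp
  ultimately show ?thesis by metis
qed

text \<open>At positions 0 and 1 the products of the first two columns vanish by the zero diagonal;
  the other \<open>n - 2\<close> are signs with sum 0.\<close>

lemma conference_matrix_even:
  assumes C: "conference_matrix n C" and n: "2 \<le> n"
  shows "even n"
proof -
  define W where "W = {..<n} - {0, 1}"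
  have pm: "C $$ (k, 0) * C $$ (k, 1) \<in> {1, -1}" if "k \<in> W" for k
  proof -
    have "C $$ (k, 0) \<in> {1, -1}" "C $$ (k, 1) \<in> {1, -1}"
      using C that n unfolding conference_matrix_def W_def by auto
    then show ?thesis by auto
  qed
  have "(\<Sum>k<n. C $$ (k, 0) * C $$ (k, 1)) = (\<Sum>k\<in>W. C $$ (k, 0) * C $$ (k, 1))"
    using C n by (intro sum.mono_neutral_right) (auto simp: W_def conference_matrix_def)
  then have "(\<Sum>k\<in>W. C $$ (k, 0) * C $$ (k, 1)) = 0"
    using conference_matrix_columns[OF C, of 0 1] n by simp
  then have "even (card W)"
    using even_card_if_signs_cancel[of W "\<lambda>k. C $$ (k, 0) * C $$ (k, 1)"] pm by (simp add: W_def)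
  moreover have "card W = n - 2" using n by (simp add: W_def card_Diff_subset)
  ultimately show ?thesis using n by simp
qed

lemma ramsey_of_conference_matrix:
  assumes C: "conference_matrix (m + 1) C" and m: "odd m" and k: "m\<^sup>2 = 4 * k + 1"
  shows "r2' (complete_bipartite 2 (3 * k + 1)) = 4 * k + 3 \<and>
    CR (complete_bipartite 2 (3 * k + 1)) (complete_graph 3) = 4 * k + 3"
proof -
  \<comment> \<open>The definition makes columns orthogonal; transposing allows working with
    rows.\<close>
  define c where "c i j = C $$ (j, i)" for i j
  have diag: "c i i = 0" if "i \<le> m" for i
    using C that by (auto simp: conference_matrix_def c_def)
  have pm: "c i j \<in> {1, -1}" if "i \<le> m" "j \<le> m" "i \<noteq> j" for i j
    using C that unfolding conference_matrix_def c_def by (metis less_add_one order_le_less_trans)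
  have split: "sum g {..<m + 1} = g 0 + sum g {1..m}" for g :: "nat \<Rightarrow> real"
  proof -
    have "{..<m + 1} = insert 0 {1..m}" by auto
    then show ?thesis by simp
  qed
  have orth: "c i 0 * c j 0 + (\<Sum>k=1..m. c i k * c j k) = 0" if "i \<le> m" "j \<le> m" "i \<noteq> j" for i j
    using conference_matrix_columns[OF C, of i j] that split[of "\<lambda>k. c i k * c j k"]
    by (simp add: c_def)
  have sq: "c i j * c i j = 1" if "i \<le> m" "j \<le> m" "i \<noteq> j" for i j
    using pm[OF that] by auto
  \<comment> \<open>Scaling rows and columns by the border signs turns the border into ones, and
    \<open>S\<close> is the core left on \<open>{1..m}\<close>. Its row sums vanish by orthogonality
    to row 0.\<close>
  define S where "S i j = c i 0 * c i j * c 0 j" for i j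
  show ?thesis
  proof (rule ramsey_of_core[where I = "{1..m}" and S = S])
    show "odd (card {1..m})" "(card {1..m})\<^sup>2 = 4 * k + 1" using m k by simp_all
    show "S i i = 0" if "i \<in> {1..m}" for i using diag that by (simp add: S_def)
    show "S i j \<in> {1, -1}" if "i \<in> {1..m}" "j \<in> {1..m}" "i \<noteq> j" for i j
      using pm[of i 0] pm[of i j] pm[of 0 j] that by (auto simp: S_def)
    show "(\<Sum>k=1..m. S i k) = 0" if "i \<in> {1..m}" for i
      using orth[of i 0] diag[of 0] that by (simp add: S_def mult.assoc flip: sum_distrib_left)
    show "(\<Sum>k=1..m. S i k * S j k) = -1" if "i \<in> {1..m}" "j \<in> {1..m}" "i \<noteq> j" for i j
    proof -
      have "(\<Sum>k=1..m. S i k * S j k) = (\<Sum>k=1..m. c i 0 * c j 0 * (c i k * c j k))"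
      proof (rule sum.cong)
        fix k assume "k \<in> {1..m}"
        then have "c 0 k * c 0 k = 1" using sq by simp
        moreover have "S i k * S j k = c i 0 * c j 0 * (c i k * c j k) * (c 0 k * c 0 k)"
          by (simp add: S_def)
        ultimately show "S i k * S j k = c i 0 * c j 0 * (c i k * c j k)" by simp
      qed simp
      also have "\<dots> = c i 0 * c j 0 * (\<Sum>k=1..m. c i k * c j k)" by (simp add: sum_distrib_left)
      also have "(\<Sum>k=1..m. c i k * c j k) = - (c i 0 * c j 0)" using orth[of i j] that by simp
      also have "c i 0 * c j 0 * - (c i 0 * c j 0) = - ((c i 0 * c i 0) * (c j 0 * c j 0))"
        by (simp add: mult_ac)
      also have "\<dots> = -1" using sq that by simp
      finally show ?thesis .
    qed
  qed simp
qed

lemma ramsey_of_regular_symmetric_conference_matrix: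
  assumes C: "symmetric_conference_matrix (m\<^sup>2 + 1) C" and reg: "regular_conference_matrix (m\<^sup>2 + 1) C"
    and k: "m\<^sup>2 = 4 * k + 1"
  shows "r2' (complete_bipartite 2 (3 * k + 1)) = 4 * k + 3 \<and>
    CR (complete_bipartite 2 (3 * k + 1)) (complete_graph 3) = 4 * k + 3"
proof -
  let ?n = "m\<^sup>2 + 1"
  have conf: "conference_matrix ?n C" and symm: "transpose_mat C = C"
    using C by (auto simp: symmetric_conference_matrix_def)
  have dim: "dim_row C = ?n" "dim_col C = ?n" using conf by (auto simp: conference_matrix_def)
  have sym: "C $$ (i, j) = C $$ (j, i)" if "i < ?n" "j < ?n" for i j
    using that dim index_transpose_mat(1)[of i C j] unfolding symm by simp
  \<comment> \<open>One unspecified \<open>s\<close> covers both signs of the square root.\<close>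
  obtain s where s: "C *\<^sub>v all_ones_vec ?n = s \<cdot>\<^sub>v all_ones_vec ?n"
    using reg unfolding regular_conference_matrix_def by blast
  show ?thesis
  proof (rule ramsey_of_regular_symmetric_conference[where V = "{..<?n}" and C = "\<lambda>i j. C $$ (i, j)" and s = s])
    show "card {..<?n} = 4 * k + 2" using k by simp
    show "C $$ (i, i) = 0" if "i \<in> {..<?n}" for i
      using conf that unfolding conference_matrix_def by auto
    show "C $$ (i, j) \<in> {1, -1}" if "i \<in> {..<?n}" "j \<in> {..<?n}" "i \<noteq> j" for i j
      using conf that unfolding conference_matrix_def by blast
    show "C $$ (i, j) = C $$ (j, i)" if "i \<in> {..<?n}" "j \<in> {..<?n}" for i j
      using sym that by simp
    show "(\<Sum>w<?n. C $$ (i, w) * C $$ (j, w)) = 0" if "i \<in> {..<?n}" "j \<in> {..<?n}" "i \<noteq> j" for i j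
    proof -
      have "(\<Sum>w<?n. C $$ (i, w) * C $$ (j, w)) = (\<Sum>w<?n. C $$ (w, i) * C $$ (w, j))"
        using sym that by (intro sum.cong) auto
      then show ?thesis using conference_matrix_columns[OF conf] that by simp
    qed
    show "(\<Sum>w<?n. C $$ (i, w)) = s" if "i \<in> {..<?n}" for i
    proof -
      have "(C *\<^sub>v all_ones_vec ?n) $ i = (s \<cdot>\<^sub>v all_ones_vec ?n) $ i" using s by simp
      then show ?thesis
        using that dim by (simp add: all_ones_vec_def scalar_prod_def atLeast0LessThan)
    qed
  qed simp
qed

section \<open>Arithmetic of the indices and the four cases\<close>

lemma odd_square_mod_4:
  fixes m :: nat
  assumes "odd m"
  obtains k where "m\<^sup>2 = 4 * k + 1"
proof -
  obtain j where "m = 2 * j + 1" using assms by (rule oddE)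
  then have "m\<^sup>2 = 4 * (j * j + j) + 1" by (simp add: power2_eq_square algebra_simps)
  then show thesis by (rule that)
qed

theorem theorem1p11:
  fixes m :: nat
  assumes "m > 0"
  shows
    "(m \<ge> 2 \<and> (\<exists>H. hadamard_matrix m H) \<longrightarrow>
        r2' (complete_bipartite 2 (3 * m\<^sup>2 div 4 - 1)) = m\<^sup>2 \<and>
        CR (complete_bipartite 2 (3 * m\<^sup>2 div 4 - 1)) (complete_graph 3) = m\<^sup>2) \<and>
     ((\<exists>H. graphical_hadamard_matrix (4 * m\<^sup>2) H) \<longrightarrow>
        r2' (complete_bipartite 2 (3 * m\<^sup>2 - 1)) = 4 * m\<^sup>2 \<and>
        CR (complete_bipartite 2 (3 * m\<^sup>2 - 1)) (complete_graph 3) = 4 * m\<^sup>2) \<and>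
     ((\<exists>C. conference_matrix (m + 1) C) \<longrightarrow>
        r2' (complete_bipartite 2 ((3 * m\<^sup>2 + 1) div 4)) = m\<^sup>2 + 2 \<and>
        CR (complete_bipartite 2 ((3 * m\<^sup>2 + 1) div 4)) (complete_graph 3) = m\<^sup>2 + 2) \<and>
     ((\<exists>C. symmetric_conference_matrix (m\<^sup>2 + 1) C \<and> regular_conference_matrix (m\<^sup>2 + 1) C) \<longrightarrow>
        r2' (complete_bipartite 2 ((3 * m\<^sup>2 + 1) div 4)) = m\<^sup>2 + 2 \<and>
        CR (complete_bipartite 2 ((3 * m\<^sup>2 + 1) div 4)) (complete_graph 3) = m\<^sup>2 + 2)"
\<comment> \<open>Only conjunctions whose left side is an implication are split, so the two
  equalities of each case stay together.\<close>
proof (intro conjI[of "_ \<longrightarrow> _"] impI)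
  assume "m \<ge> 2 \<and> (\<exists>H. hadamard_matrix m H)"
  then obtain H where H: "2 \<le> m" "hadamard_matrix m H" by blast
  obtain j where "m = 2 * j" using hadamard_matrix_even[OF H(2,1)] by (rule evenE)
  \<comment> \<open>The parameter \<open>k\<close> is \<open>j\<^sup>2\<close> here, and the
    division by 4 is exact.\<close>
  then have j: "m\<^sup>2 = 4 * j\<^sup>2" by (simp add: power2_eq_square)
  then have "3 * m\<^sup>2 div 4 - 1 = 3 * j\<^sup>2 - 1" by simp
  then show "r2' (complete_bipartite 2 (3 * m\<^sup>2 div 4 - 1)) = m\<^sup>2 \<and>
      CR (complete_bipartite 2 (3 * m\<^sup>2 div 4 - 1)) (complete_graph 3) = m\<^sup>2"
    using ramsey_of_hadamard_matrix[OF H(2,1) j] j by simp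
next
  assume "\<exists>H. graphical_hadamard_matrix (4 * m\<^sup>2) H"
  then show "r2' (complete_bipartite 2 (3 * m\<^sup>2 - 1)) = 4 * m\<^sup>2 \<and>
      CR (complete_bipartite 2 (3 * m\<^sup>2 - 1)) (complete_graph 3) = 4 * m\<^sup>2"
    using ramsey_of_graphical_hadamard_matrix[of "m\<^sup>2"] assms by auto
next
  assume "\<exists>C. conference_matrix (m + 1) C"
  then obtain C where C: "conference_matrix (m + 1) C" by blast
  have m: "odd m" using conference_matrix_even[OF C] assms by simp
  then obtain k where k: "m\<^sup>2 = 4 * k + 1" by (rule odd_square_mod_4)
  \<comment> \<open>From \<open>m\<^sup>2 = 4 * k + 1\<close> the numerator is
    \<open>12 * k + 4\<close>, so this division is exact as well.\<close>
  then have "(3 * m\<^sup>2 + 1) div 4 = 3 * k + 1" "m\<^sup>2 + 2 = 4 * k + 3" by simp_all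
  then show "r2' (complete_bipartite 2 ((3 * m\<^sup>2 + 1) div 4)) = m\<^sup>2 + 2 \<and>
      CR (complete_bipartite 2 ((3 * m\<^sup>2 + 1) div 4)) (complete_graph 3) = m\<^sup>2 + 2"
    using ramsey_of_conference_matrix[OF C m k] by simp
next
  assume "\<exists>C. symmetric_conference_matrix (m\<^sup>2 + 1) C \<and> regular_conference_matrix (m\<^sup>2 + 1) C"
  then obtain C where C: "symmetric_conference_matrix (m\<^sup>2 + 1) C" "regular_conference_matrix (m\<^sup>2 + 1) C"
    by blast
  have "even (m\<^sup>2 + 1)"
    using C(1) assms by (intro conference_matrix_even[of _ C]) (auto simp: symmetric_conference_matrix_def)
  then have "odd m" by simp
  then obtain k where k: "m\<^sup>2 = 4 * k + 1" by (rule odd_square_mod_4)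
  then have "(3 * m\<^sup>2 + 1) div 4 = 3 * k + 1" "m\<^sup>2 + 2 = 4 * k + 3" by simp_all
  then show "r2' (complete_bipartite 2 ((3 * m\<^sup>2 + 1) div 4)) = m\<^sup>2 + 2 \<and>
      CR (complete_bipartite 2 ((3 * m\<^sup>2 + 1) div 4)) (complete_graph 3) = m\<^sup>2 + 2"
    using ramsey_of_regular_symmetric_conference_matrix[OF C k] by simp
qed

end
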